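(* Let $G$ be a group admitting a length function $l$ that is both purely positive and discrete. Then every solvable subgroup of $G$ of finite virtual cohomological dimension contains a finite-index (normal) subgroup isomorphic to $\mathbb{Z}^{n}$ for some $n\geq 0$.
   Context: A length function on a group $G$ is a function $l:G\to[0,\infty)$ such that (1) $l(g^{n})=|n|\,l(g)$ for all $g\in G$, $n\in\mathbb{Z}$; (2) $l(hgh^{-1})=l(g)$ for all $g,h\in G$; (3) $l(ab)\leq l(a)+l(b)$ whenever $a,b$ commute. It is purely positive if $l(g)>0$ for every element $g$ of infinite order, and discrete if there is a constant $c>0$ such that $l(g)>c$ for every $g$ with $l(g)\neq 0$. Virtual cohomological dimension is the cohomological dimension of a torsion-free finite-index subgroup. *)

theory Defs
  imports "HOL-Algebra.Algebra"
begin

definition infinite_order :: "('a, 'b) monoid_scheme \<Rightarrow> 'a \<Rightarrow> bool" where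
  "infinite_order G g \<longleftrightarrow> (\<forall>n::nat. n \<noteq> 0 \<longrightarrow> g [^]\<^bsub>G\<^esub> n \<noteq> \<one>\<^bsub>G\<^esub>)"

definition length_function :: "('a, 'b) monoid_scheme \<Rightarrow> ('a \<Rightarrow> real) \<Rightarrow> bool" where
  "length_function G l \<longleftrightarrow>
     (\<forall>g\<in>carrier G. l g \<ge> 0) \<and>
     (\<forall>g\<in>carrier G. \<forall>n::int. l (g [^]\<^bsub>G\<^esub> n) = \<bar>real_of_int n\<bar> * l g) \<and>
     (\<forall>g\<in>carrier G. \<forall>h\<in>carrier G. l (h \<otimes>\<^bsub>G\<^esub> g \<otimes>\<^bsub>G\<^esub> inv\<^bsub>G\<^esub> h) = l g) \<and>
     (\<forall>a\<in>carrier G. \<forall>b\<in>carrier G. a \<otimes>\<^bsub>G\<^esub> b = b \<otimes>\<^bsub>G\<^esub> a \<longrightarrow>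
         l (a \<otimes>\<^bsub>G\<^esub> b) \<le> l a + l b)"

definition purely_positive :: "('a, 'b) monoid_scheme \<Rightarrow> ('a \<Rightarrow> real) \<Rightarrow> bool" where
  "purely_positive G l \<longleftrightarrow> (\<forall>g\<in>carrier G. infinite_order G g \<longrightarrow> l g > 0)"

definition discrete_lf :: "('a, 'b) monoid_scheme \<Rightarrow> ('a \<Rightarrow> real) \<Rightarrow> bool" where
  "discrete_lf G l \<longleftrightarrow> (\<exists>c>0. \<forall>g\<in>carrier G. l g \<noteq> 0 \<longrightarrow> l g > c)"

definition group_module ::
  "('a, 'c) monoid_scheme \<Rightarrow> ('m, 'd) monoid_scheme \<Rightarrow> ('a \<Rightarrow> 'm \<Rightarrow> 'm) \<Rightarrow> bool" where
  "group_module K M act \<longleftrightarrow> comm_group M \<and>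
     (\<forall>g\<in>carrier K. \<forall>m\<in>carrier M. act g m \<in> carrier M) \<and>
     (\<forall>m\<in>carrier M. act \<one>\<^bsub>K\<^esub> m = m) \<and>
     (\<forall>g\<in>carrier K. \<forall>h\<in>carrier K. \<forall>m\<in>carrier M.
         act (g \<otimes>\<^bsub>K\<^esub> h) m = act g (act h m)) \<and>
     (\<forall>g\<in>carrier K. \<forall>m\<in>carrier M. \<forall>m'\<in>carrier M.
         act g (m \<otimes>\<^bsub>M\<^esub> m') = act g m \<otimes>\<^bsub>M\<^esub> act g m')"

definition tuples :: "('a, 'c) monoid_scheme \<Rightarrow> nat \<Rightarrow> 'a list set" where
  "tuples K n = {gs. set gs \<subseteq> carrier K \<and> length gs = n}"

definition cochain ::
  "('a, 'c) monoid_scheme \<Rightarrow> ('m, 'd) monoid_scheme \<Rightarrow> nat \<Rightarrow> ('a list \<Rightarrow> 'm) \<Rightarrow> bool" where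
  "cochain K M n f \<longleftrightarrow> (\<forall>gs\<in>tuples K n. f gs \<in> carrier M)"

text \<open>merge i [g1,...,g(n+1)] = [g1,...,g(i) g(i+1),...,g(n+1)] (1-based i).\<close>
definition merge_at :: "('a, 'c) monoid_scheme \<Rightarrow> nat \<Rightarrow> 'a list \<Rightarrow> 'a list" where
  "merge_at K i gs = take (i - 1) gs @ [gs ! (i - 1) \<otimes>\<^bsub>K\<^esub> gs ! i] @ drop (i + 1) gs"

text \<open>Standard coboundary on inhomogeneous n-cochains:
 (df)(g1..g(n+1)) = g1 f(g2..g(n+1)) + sum_{i=1..n} (-1)^i f(..,g(i)g(i+1),..) + (-1)^(n+1) f(g1..gn).\<close>
definition coboundary ::
  "('a, 'c) monoid_scheme \<Rightarrow> ('m, 'd) monoid_scheme \<Rightarrow> ('a \<Rightarrow> 'm \<Rightarrow> 'm) \<Rightarrow> nat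
     \<Rightarrow> ('a list \<Rightarrow> 'm) \<Rightarrow> 'a list \<Rightarrow> 'm" where
  "coboundary K M act n f gs =
     act (gs ! 0) (f (tl gs)) \<otimes>\<^bsub>M\<^esub>
     finprod M (\<lambda>i. f (merge_at K i gs) [^]\<^bsub>M\<^esub> ((-1::int) ^ i)) {1..n} \<otimes>\<^bsub>M\<^esub>
     f (take n gs) [^]\<^bsub>M\<^esub> ((-1::int) ^ (n + 1))"

definition cocycle ::
  "('a, 'c) monoid_scheme \<Rightarrow> ('m, 'd) monoid_scheme \<Rightarrow> ('a \<Rightarrow> 'm \<Rightarrow> 'm) \<Rightarrow> nat
     \<Rightarrow> ('a list \<Rightarrow> 'm) \<Rightarrow> bool" where
  "cocycle K M act n f \<longleftrightarrow> cochain K M n f \<and>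
     (\<forall>gs\<in>tuples K (Suc n). coboundary K M act n f gs = \<one>\<^bsub>M\<^esub>)"

text \<open>H^(Suc n)(K, M) = 0: every (n+1)-cocycle is the coboundary of an n-cochain.\<close>
definition cohomology_vanishes ::
  "('a, 'c) monoid_scheme \<Rightarrow> ('m, 'd) monoid_scheme \<Rightarrow> ('a \<Rightarrow> 'm \<Rightarrow> 'm) \<Rightarrow> nat \<Rightarrow> bool" where
  "cohomology_vanishes K M act n \<longleftrightarrow>
     (\<forall>f. cocycle K M act (Suc n) f \<longrightarrow>
        (\<exists>h. cochain K M n h \<and> (\<forall>gs\<in>tuples K (Suc n). f gs = coboundary K M act n h gs)))"

definition cd_le :: "('a, 'c) monoid_scheme \<Rightarrow> nat \<Rightarrow> bool" where
  "cd_le K n \<longleftrightarrow>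
     (\<forall>(M :: 'a list monoid) (act :: 'a \<Rightarrow> 'a list \<Rightarrow> 'a list).
        group_module K M act \<longrightarrow> cohomology_vanishes K M act n)"

definition torsion_free :: "('a, 'c) monoid_scheme \<Rightarrow> bool" where
  "torsion_free K \<longleftrightarrow> (\<forall>g\<in>carrier K. g \<noteq> \<one>\<^bsub>K\<^esub> \<longrightarrow> infinite_order K g)"

definition finite_vcd :: "('a, 'c) monoid_scheme \<Rightarrow> bool" where
  "finite_vcd H \<longleftrightarrow> (\<exists>K n. subgroup K H \<and> finite (rcosets\<^bsub>H\<^esub> K) \<and>
      torsion_free (H\<lparr>carrier := K\<rparr>) \<and> cd_le (H\<lparr>carrier := K\<rparr>) n)"

end

theory Submission
  imports Defs
begin

text \<open>
  Let \<open>K\<close> be the torsion-free subgroup of finite index and finite cohomological dimension \<open>n\<close>.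

  If \<open>e\<^sub>0, \<dots>, e\<^sub>n \<in> K\<close> commute and are independent, choose \<open>\<chi>\<^sub>i : K \<rightarrow> \<int>\<close> with
  \<open>\<chi>\<^sub>i (e\<^sub>j x) = \<chi>\<^sub>i x + \<delta>\<^sub>i\<^sub>j\<close>. The cup product of the 1-cocycles \<open>g \<mapsto> (x \<mapsto> \<chi>\<^sub>i (x g) - \<chi>\<^sub>i x)\<close>, with values in
  the functions on \<open>K\<close> invariant under all \<open>e\<^sub>j\<close>, is an \<open>(n+1)\<close>-cocycle whose antisymmetrisation on the
  \<open>e\<^sub>j\<close> is \<open>1\<close>, whereas it is \<open>0\<close> for a coboundary. Hence abelian subgroups of \<open>K\<close> have rank at most \<open>n\<close>.

  On such an abelian subgroup the length is a norm bounded below by some \<open>c > 0\<close> off \<open>\<one>\<close>. By simultaneous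
  Diophantine approximation its balls are finite, so the subgroup is isomorphic to some \<open>\<int>\<^sup>r\<close>.

  A commutator \<open>[a, b]\<close> commuting with \<open>a\<close> and \<open>b\<close> has length \<open>0\<close>, hence is trivial. Together with
  solvability this shows that a maximal conjugation-invariant commuting subset \<open>A\<close> of \<open>K\<close> is its own
  centraliser. Conjugation permutes a finite ball of \<open>A\<close> that contains a rational basis, and the kernel
  of this action is \<open>A\<close>; so \<open>A\<close> has finite index, and one passes to its normal core.
\<close>

section \<open>Integral combinations in abelian groups\<close>

primrec int_comb :: "('a, 'b) monoid_scheme \<Rightarrow> (nat \<Rightarrow> 'a) \<Rightarrow> (nat \<Rightarrow> int) \<Rightarrow> nat \<Rightarrow> 'a" where
  "int_comb G e x 0 = \<one>\<^bsub>G\<^esub>"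
| "int_comb G e x (Suc r) = int_comb G e x r \<otimes>\<^bsub>G\<^esub> (e r [^]\<^bsub>G\<^esub> x r)"

definition int_independent :: "('a, 'b) monoid_scheme \<Rightarrow> (nat \<Rightarrow> 'a) \<Rightarrow> nat \<Rightarrow> bool" where
  "int_independent G e r \<longleftrightarrow> (\<forall>i<r. e i \<in> carrier G) \<and>
     (\<forall>x. int_comb G e x r = \<one>\<^bsub>G\<^esub> \<longrightarrow> (\<forall>i<r. x i = 0))"

text \<open>In a commutative group, truncating an independent family keeps it independent
  (\<open>int_independent_SucD\<close>), so excluding the single length \<open>Suc n\<close>
  excludes every length above \<open>n\<close>.\<close>

definition rank_le :: "('a, 'b) monoid_scheme \<Rightarrow> nat \<Rightarrow> bool" where
  "rank_le G n \<longleftrightarrow> (\<forall>e. \<not> int_independent G e (Suc n))"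

text \<open>In a commutative group this says that the \<open>e i\<close> become a basis of the
  tensor product with the rationals. Since \<open>k\<close> depends on \<open>a\<close>, finite
  generation is not implied.\<close>

definition rational_basis :: "('a, 'b) monoid_scheme \<Rightarrow> (nat \<Rightarrow> 'a) \<Rightarrow> nat \<Rightarrow> bool" where
  "rational_basis G e r \<longleftrightarrow> int_independent G e r \<and>
     (\<forall>a\<in>carrier G. \<exists>k>0::int. \<exists>x. a [^]\<^bsub>G\<^esub> k = int_comb G e x r)"

lemma int_comb_cong: "(\<And>i. i < r \<Longrightarrow> e i = e' i) \<Longrightarrow> (\<And>i. i < r \<Longrightarrow> x i = x' i) \<Longrightarrow> int_comb G e x r = int_comb G e' x' r"
  by (induction r) auto

lemma (in group) int_comb_closed [simp]: "\<forall>i<r. e i \<in> carrier G \<Longrightarrow> int_comb G e x r \<in> carrier G"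
  by (induction r) auto

lemma (in group) int_comb_zero: "\<forall>i<r. e i \<in> carrier G \<Longrightarrow> \<forall>i<r. x i = 0 \<Longrightarrow> int_comb G e x r = \<one>"
  by (induction r) auto

context comm_group
begin

section \<open>Calculus of integral combinations\<close>

lemma int_comb_add:
  assumes "\<forall>i<r. e i \<in> carrier G"
  shows "int_comb G e (\<lambda>i. x i + y i) r = int_comb G e x r \<otimes> int_comb G e y r"
  using assms
proof (induction r)
  case (Suc r)
  let ?a = "int_comb G e x r" and ?b = "int_comb G e y r" and ?u = "e r [^] x r" and ?v = "e r [^] y r"
  have "?a \<in> carrier G" "?b \<in> carrier G" "?u \<in> carrier G" "?v \<in> carrier G"
    using Suc.prems by auto
  moreover have "int_comb G e (\<lambda>i. x i + y i) (Suc r) = (?a \<otimes> ?b) \<otimes> (?u \<otimes> ?v)"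
    using Suc by (simp add: int_pow_mult)
  ultimately show ?case
    by (simp add: m_ac)
qed simp

lemma int_comb_pow:
  assumes "\<forall>i<r. e i \<in> carrier G"
  shows "int_comb G e (\<lambda>i. k * x i) r = int_comb G e x r [^] (k::int)"
  using assms
proof (induction r)
  case (Suc r)
  then show ?case
    by (simp add: int_pow_distrib int_pow_pow mult.commute)
qed simp

lemma int_comb_minus:
  assumes "\<forall>i<r. e i \<in> carrier G"
  shows "int_comb G e (\<lambda>i. - x i) r = inv (int_comb G e x r)"
  using int_comb_pow[OF assms, of "-1" x] assms by (simp add: int_pow_neg)

lemma int_comb_diff:
  assumes "\<forall>i<r. e i \<in> carrier G"
  shows "int_comb G e (\<lambda>i. x i - y i) r = int_comb G e x r \<otimes> inv (int_comb G e y r)"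
  using int_comb_add[OF assms, of x "\<lambda>i. - y i"] int_comb_minus[OF assms] by simp

lemma int_comb_unit:
  assumes "\<forall>i<r. e i \<in> carrier G" "j < r"
  shows "int_comb G e (\<lambda>i. if i = j then 1 else 0) r = e j"
  using assms
proof (induction r)
  case (Suc r)
  show ?case
  proof (cases "j = r")
    case True
    then show ?thesis using Suc.prems by (simp add: int_comb_zero)
  next
    case False
    then show ?thesis using Suc by simp
  qed
qed simp

lemma int_comb_pow_base:
  assumes "\<forall>i<r. e i \<in> carrier G"
  shows "int_comb G (\<lambda>i. e i [^] (k::int)) x r = int_comb G e x r [^] k"
  using assms
proof (induction r)
  case (Suc r)
  then show ?case
    by (simp add: int_pow_distrib int_pow_pow mult.commute)
qed simp

section \<open>Independence, rank and bases\<close>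

lemma int_independentD:
  "int_independent G e r \<Longrightarrow> int_comb G e x r = \<one> \<Longrightarrow> i < r \<Longrightarrow> x i = 0"
  by (auto simp: int_independent_def)

lemma int_independent_carrier: "int_independent G e r \<Longrightarrow> \<forall>i<r. e i \<in> carrier G"
  by (auto simp: int_independent_def)

lemma int_independent_inject:
  assumes "int_independent G e r" "int_comb G e x r = int_comb G e y r" "i < r"
  shows "x i = y i"
proof -
  note car = int_independent_carrier[OF assms(1)]
  have "int_comb G e (\<lambda>i. x i - y i) r = \<one>"
    by (simp add: int_comb_diff[OF car] assms(2) car)
  from int_independentD[OF assms(1) this assms(3)] show ?thesis by simp
qed

lemma int_independent_SucD: assumes "int_independent G e (Suc r)" shows "int_independent G e r"
  unfolding int_independent_def
proof (intro conjI allI impI)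
  fix i assume "i < r"
  then show "e i \<in> carrier G" using assms by (simp add: int_independent_def)
next
  fix x i assume *: "int_comb G e x r = \<one>" "i < r"
  have "int_comb G e (x(r := 0)) r = int_comb G e x r"
    by (rule int_comb_cong) auto
  then have "int_comb G e (x(r := 0)) (Suc r) = \<one>"
    using * by simp
  from int_independentD[OF assms this, of i] * show "x i = 0" by simp
qed

text \<open>A longest independent family works: appending any further element \<open>a\<close>
  creates a relation, and this relation must involve \<open>a\<close>.\<close>

lemma rank_le_imp_rational_basis:
  assumes "rank_le G n"
  obtains e r where "rational_basis G e r"
proof -
  let ?R = "{r. \<exists>e. int_independent G e r}"
  have bound: "int_independent G e r \<Longrightarrow> r \<le> n" for e r
  proof (rule ccontr)
    assume "int_independent G e r" "\<not> r \<le> n"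
    moreover have "int_independent G e (k + m) \<Longrightarrow> int_independent G e m" for k m
      by (induction k) (auto dest: int_independent_SucD)
    moreover from \<open>\<not> r \<le> n\<close> obtain k where "r = k + Suc n"
      by (metis add.commute le_Suc_ex not_less_eq_eq)
    ultimately have "int_independent G e (Suc n)" by blast
    then show False
      using assms by (auto simp: rank_le_def)
  qed
  then have fin: "finite ?R" by (auto intro: finite_subset[of _ "{..n}"])
  have "0 \<in> ?R" by (auto simp: int_independent_def)
  define r where "r = Max ?R"
  have "r \<in> ?R" unfolding r_def using fin \<open>0 \<in> ?R\<close> by (intro Max_in) auto
  then obtain e where e: "int_independent G e r" by auto
  note car = int_independent_carrier[OF e]
  have "\<exists>k>0::int. \<exists>x. a [^] k = int_comb G e x r" if a: "a \<in> carrier G" for a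
  proof -
    have "Suc r \<notin> ?R"
      using Max_ge[OF fin, of "Suc r"] unfolding r_def[symmetric] by auto
    then have "\<not> int_independent G (e(r := a)) (Suc r)" by auto
    then obtain x i where x: "int_comb G (e(r := a)) x (Suc r) = \<one>" "i < Suc r" "x i \<noteq> 0"
      using car a by (auto simp: int_independent_def less_Suc_eq)
    have "int_comb G (e(r := a)) x r = int_comb G e x r" by (rule int_comb_cong) auto
    with x have eq: "int_comb G e x r \<otimes> a [^] x r = \<one>" by simp
    \<comment> \<open>Otherwise the relation would only involve \<open>e\<close>, whose independence
      would force all coefficients to be zero.\<close>
    have "x r \<noteq> 0"
    proof
      assume "x r = 0"
      with eq have "int_comb G e x r = \<one>" using car by simp
      with x \<open>x r = 0\<close> show False using int_independentD[OF e, of x i] by (cases "i = r") auto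
    qed
    have eq1: "a [^] (- x r) = int_comb G e x r"
      using eq a car by (simp add: int_pow_neg inv_equality)
    have "a [^] (x r) = inv (int_comb G e x r)"
      using eq a car by (metis inv_equality m_comm int_comb_closed int_pow_closed)
    also have "\<dots> = int_comb G e (\<lambda>i. - x i) r" by (simp add: int_comb_minus[OF car])
    finally have eq2: "a [^] (x r) = int_comb G e (\<lambda>i. - x i) r" .
    show ?thesis
    proof (cases "x r > 0")
      case True then show ?thesis using eq2 by blast
    next
      case False with \<open>x r \<noteq> 0\<close> have "- x r > 0" by simp
      then show ?thesis using eq1 by blast
    qed
  qed
  with e that show ?thesis by (auto simp: rational_basis_def)
qed

text \<open>Subgroups of a free abelian group of finite rank are free, by induction on the rank: the
  last coordinates of \<open>H\<close> are the multiples of some \<open>d\<close>, the elements with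
  last coordinate 0 are covered by the induction hypothesis, and an element \<open>h\<close> with
  last coordinate \<open>d\<close> splits off a cyclic factor.\<close>

lemma subgroup_of_span_has_basis:
  assumes "int_independent G e r" "subgroup H G" "H \<subseteq> range (\<lambda>x. int_comb G e x r)"
  shows "\<exists>f s. int_independent G f s \<and> H = range (\<lambda>y. int_comb G f y s)"
  using assms
proof (induction r arbitrary: H)
  case 0
  then have "H = {\<one>}" using subgroup.one_closed[OF 0(2)] by auto
  then have "int_independent G e 0 \<and> H = range (\<lambda>y. int_comb G e y 0)"
    by (auto simp: int_independent_def)
  then show ?case by blast
next
  case (Suc r)
  interpret H: subgroup H G by fact
  note ind = int_independent_SucD[OF Suc.prems(1)]
  note car = int_independent_carrier[OF Suc.prems(1)] and car' = int_independent_carrier[OF ind]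
  show ?case
  proof (cases "\<forall>x. int_comb G e x (Suc r) \<in> H \<longrightarrow> x r = 0")
    case True
    have "H \<subseteq> range (\<lambda>x. int_comb G e x r)"
    proof
      fix h assume h: "h \<in> H"
      then obtain x where x: "h = int_comb G e x (Suc r)" using Suc.prems(3) by auto
      with True h have "x r = 0" by blast
      with x have "h = int_comb G e x r" using car' by simp
      then show "h \<in> range (\<lambda>x. int_comb G e x r)" by blast
    qed
    from Suc.IH[OF ind Suc.prems(2) this] show ?thesis .
  next
    case False
    \<comment> \<open>\<open>d\<close> will be the least positive last coordinate occurring in
      \<open>H\<close>; negating \<open>x\<close> if necessary shows that there is one.\<close>
    define P where "P = (\<lambda>d. d > 0 \<and> (\<exists>x. int_comb G e x (Suc r) \<in> H \<and> x r = int d))"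
    from False obtain x where x: "int_comb G e x (Suc r) \<in> H" "x r \<noteq> 0" by blast
    have "int_comb G e (\<lambda>i. - x i) (Suc r) \<in> H"
      using int_comb_minus[OF car, of x] x H.m_inv_closed by simp
    with x have "P (nat \<bar>x r\<bar>)"
      unfolding P_def by (cases "x r > 0") (auto simp del: int_comb.simps intro: exI[of _ x] exI[of _ "\<lambda>i. - x i"])
    define d where "d = (LEAST d. P d)"
    have "P d" unfolding d_def by (rule LeastI) fact
    then obtain w where w: "int_comb G e w (Suc r) \<in> H" "w r = int d" and d: "d > 0"
      by (auto simp: P_def)
    have least: "P k \<Longrightarrow> d \<le> k" for k unfolding d_def by (rule Least_le)
    define h where "h = int_comb G e w (Suc r)"
    have hH: "h \<in> H" and hG: "h \<in> carrier G" using w by (auto simp: h_def)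
    \<comment> \<open>Division with remainder: subtracting \<open>q\<close> copies of
      \<open>w\<close> leaves the remainder as last coordinate, and minimality of \<open>d\<close>
      makes it zero.\<close>
    have dv: "int d dvd y r" if "int_comb G e y (Suc r) \<in> H" for y
    proof -
      define q where "q = y r div int d"
      have "int_comb G e (\<lambda>i. y i - q * w i) (Suc r) = int_comb G e y (Suc r) \<otimes> inv (h [^] q)"
        unfolding int_comb_diff[OF car] int_comb_pow[OF car] h_def ..
      also have "\<dots> \<in> H" using that hH H.m_closed H.m_inv_closed subgroup_int_pow_closed[OF Suc.prems(2)] by simp
      finally have *: "int_comb G e (\<lambda>i. y i - q * w i) (Suc r) \<in> H" .
      have m: "y r - q * w r = y r mod int d" unfolding q_def w by (simp add: minus_div_mult_eq_mod)
      have "y r mod int d = 0"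
      proof (rule ccontr)
        assume "y r mod int d \<noteq> 0"
        moreover have "0 \<le> y r mod int d" "y r mod int d < int d"
          using d by auto
        ultimately have "nat (y r mod int d) > 0" "nat (y r mod int d) < d"
          and "y r - q * w r = int (nat (y r mod int d))"
          using m by auto
        with * have "P (nat (y r mod int d))"
          unfolding P_def by blast
        from least[OF this] \<open>nat (y r mod int d) < d\<close> show False by simp
      qed
      then show ?thesis by auto
    qed
    define E where "E = range (\<lambda>x. int_comb G e x r)"
    have subE: "subgroup E G"
    proof (rule subgroupI)
      show "E \<subseteq> carrier G" using car' by (auto simp: E_def)
      show "E \<noteq> {}" by (auto simp: E_def)
    next
      fix a assume "a \<in> E"
      then show "inv a \<in> E" unfolding E_def using int_comb_minus[OF car', symmetric] by auto
    next
      fix a b assume "a \<in> E" "b \<in> E"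
      then show "a \<otimes> b \<in> E" unfolding E_def using int_comb_add[OF car', symmetric] by auto
    qed
    have sub': "subgroup (H \<inter> E) G" by (intro subgroups_Inter_pair Suc.prems subE)
    from Suc.IH[OF ind sub'] obtain f s where f: "int_independent G f s"
      and HE: "H \<inter> E = range (\<lambda>y. int_comb G f y s)" by (auto simp: E_def)
    note carf = int_independent_carrier[OF f]
    let ?f = "f(s := h)"
    have car2: "\<forall>i<Suc s. ?f i \<in> carrier G" using carf hG by auto
    have feq: "int_comb G ?f y (Suc s) = int_comb G f y s \<otimes> h [^] y s" for y
    proof -
      have "int_comb G ?f y s = int_comb G f y s" by (rule int_comb_cong) auto
      then show ?thesis by simp
    qed
    have "int_independent G ?f (Suc s)"
      unfolding int_independent_def
    proof (intro conjI car2 allI impI)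
      fix y i assume y: "int_comb G ?f y (Suc s) = \<one>" and i: "i < Suc s"
      have "int_comb G f y s \<in> E" using HE by blast
      then obtain v where v: "int_comb G f y s = int_comb G e v r" by (auto simp: E_def)
      \<comment> \<open>The coefficient at \<open>r\<close> is not read by \<open>int_comb\<close>
        up to \<open>r\<close>, but it is read up to \<open>Suc r\<close>. With it cleared, the last
        coordinate of the combined relation is exactly \<open>y s * int d\<close>.\<close>
      define v' where "v' = v(r := 0)"
      have "int_comb G e v' r = int_comb G e v r" unfolding v'_def by (rule int_comb_cong) auto
      then have v': "int_comb G f y s = int_comb G e v' (Suc r)" using v car' by (simp add: v'_def)
      have "int_comb G e (\<lambda>i. v' i + y s * w i) (Suc r) = \<one>"
        unfolding int_comb_add[OF car] int_comb_pow[OF car] v'[symmetric] h_def[symmetric] y[unfolded feq] ..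
      from int_independentD[OF Suc.prems(1) this, of r] have ys: "y s = 0" using d w by (simp add: v'_def)
      with y have "int_comb G f y s = \<one>" unfolding feq using carf by simp
      then show "y i = 0" using ys i int_independentD[OF f, of y i] by (cases "i = s") auto
    qed
    moreover have "H = range (\<lambda>y. int_comb G ?f y (Suc s))"
    proof (intro equalityI subsetI)
      fix a assume a: "a \<in> H"
      then obtain x where x: "a = int_comb G e x (Suc r)" using Suc.prems(3) by auto
      with a obtain q where q: "x r = int d * q" using dv by (metis dvdE)
      \<comment> \<open>Removing \<open>q\<close> copies of \<open>h\<close> kills the last
        coordinate, so what remains lies in \<open>H \<inter> E\<close>.\<close>
      let ?x = "\<lambda>i. x i - q * w i"
      have "int_comb G e ?x (Suc r) = a \<otimes> inv (h [^] q)"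
        unfolding int_comb_diff[OF car] int_comb_pow[OF car] h_def x ..
      moreover have "int_comb G e ?x (Suc r) = int_comb G e ?x r"
        using q w car' by (simp add: mult.commute)
      ultimately have "a \<otimes> inv (h [^] q) \<in> E" by (auto simp: E_def)
      moreover have "a \<otimes> inv (h [^] q) \<in> H"
        using a hH subgroup_int_pow_closed[OF Suc.prems(2)] by simp
      ultimately obtain y where y: "a \<otimes> inv (h [^] q) = int_comb G f y s" using HE by blast
      let ?y = "y(s := q)"
      have "int_comb G f ?y s = int_comb G f y s" by (rule int_comb_cong) auto
      then have "int_comb G ?f ?y (Suc s) = a \<otimes> inv (h [^] q) \<otimes> h [^] q" unfolding feq by (simp add: y)
      also have "\<dots> = a" using a hG H.subset by (simp add: m_assoc subsetD)
      finally show "a \<in> range (\<lambda>y. int_comb G ?f y (Suc s))" by (metis rangeI)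
    next
      fix a assume "a \<in> range (\<lambda>y. int_comb G ?f y (Suc s))"
      then obtain y where "a = int_comb G f y s \<otimes> h [^] y s" unfolding feq by auto
      then show "a \<in> H" using HE hH subgroup_int_pow_closed[OF Suc.prems(2)] by blast
    qed
    ultimately show ?thesis by blast
  qed
qed

lemma basis_imp_iso:
  assumes "int_independent G b s" "carrier G \<subseteq> range (\<lambda>y. int_comb G b y s)"
  shows "G \<cong> product_group {..<s} (\<lambda>_. integer_group)"
proof -
  note car = int_independent_carrier[OF assms(1)]
  let ?Z = "product_group {..<s} (\<lambda>_. integer_group)"
  have "(\<lambda>x. int_comb G b x s) \<in> iso ?Z G"
  proof (rule isoI)
    show "(\<lambda>x. int_comb G b x s) \<in> hom ?Z G"
    proof (rule homI)
      fix x y assume "x \<in> carrier ?Z" "y \<in> carrier ?Z"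
      have "int_comb G b (x \<otimes>\<^bsub>?Z\<^esub> y) s = int_comb G b (\<lambda>i. x i + y i) s"
        by (rule int_comb_cong) auto
      then show "int_comb G b (x \<otimes>\<^bsub>?Z\<^esub> y) s = int_comb G b x s \<otimes> int_comb G b y s"
        by (simp only: int_comb_add[OF car])
    qed (use car in simp)
    show "bij_betw (\<lambda>x. int_comb G b x s) (carrier ?Z) (carrier G)"
      unfolding bij_betw_def
    proof
      show "inj_on (\<lambda>x. int_comb G b x s) (carrier ?Z)"
      proof (rule inj_onI)
        fix x y assume xy: "x \<in> carrier ?Z" "y \<in> carrier ?Z" "int_comb G b x s = int_comb G b y s"
        show "x = y"
        proof (rule PiE_ext)
          show "x i = y i" if "i \<in> {..<s}" for i
            using int_independent_inject[OF assms(1) xy(3)] that by simp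
        qed (use xy in auto)
      qed
      show "(\<lambda>x. int_comb G b x s) ` carrier ?Z = carrier G"
      proof (intro equalityI subsetI)
        fix a assume "a \<in> carrier G"
        with assms(2) obtain y where "a = int_comb G b y s" by blast
        moreover have "int_comb G b y s = int_comb G b (restrict y {..<s}) s" by (rule int_comb_cong) auto
        ultimately show "a \<in> (\<lambda>x. int_comb G b x s) ` carrier ?Z" by auto
      qed (use car in auto)
    qed
  qed
  then have "?Z \<cong> G" by (auto simp: is_iso_def)
  then show ?thesis by (rule group.iso_sym[rotated]) simp
qed

end

section \<open>Discrete norms on abelian groups of finite rank\<close>

lemma abs_diff_less_of_div_eq:
  fixes u v D M :: int
  assumes "M > 0" "u * D div M = v * D div M"
  shows "\<bar>u - v\<bar> * D < M"
proof -
  have "u * D mod M = u * D - M * (u * D div M)" "v * D mod M = v * D - M * (v * D div M)"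
    by (simp_all add: minus_mult_div_eq_mod)
  then have "(u - v) * D = u * D mod M - v * D mod M"
    using assms(2) by (simp add: left_diff_distrib)
  moreover have "0 \<le> u * D mod M" "u * D mod M < M" "0 \<le> v * D mod M" "v * D mod M < M"
    using assms(1) by auto
  ultimately have "(u - v) * D < M" "- ((u - v) * D) < M" by linarith+
  then show ?thesis by (cases "u \<ge> v") (simp_all add: abs_if algebra_simps)
qed

text \<open>Dirichlet's pigeonhole argument: for j from 0 to \<open>D ^ r\<close>, the vectors of
  residues of \<open>j * x i\<close> modulo \<open>M\<close> fall into \<open>D ^ r\<close> boxes of
  side M / D. Two of them share a box; the difference of their indices is \<open>d\<close>, and the
  difference of the integer parts is \<open>z\<close>.\<close>

lemma simultaneous_approximation:
  fixes x :: "nat \<Rightarrow> int" and D :: nat and M :: int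
  assumes "D > 0" "M > 0"
  obtains d :: nat and z where "0 < d" "d \<le> D ^ r" "\<And>i. i < r \<Longrightarrow> \<bar>int d * x i - M * z i\<bar> * int D < M"
proof -
  define g where "g = (\<lambda>j::nat. \<lambda>i\<in>{..<r}. ((int j * x i) mod M) * int D div M)"
  let ?B = "PiE {..<r} (\<lambda>_. {0..<int D})"
  have "g ` {0..D ^ r} \<subseteq> ?B"
  proof -
    have "0 \<le> u mod M * int D div M \<and> u mod M * int D div M < int D" for u
    proof -
      have "0 \<le> u mod M" "u mod M < M" using assms by auto
      then have "u mod M * int D < M * int D" using assms by simp
      moreover have "M * (u mod M * int D div M) \<le> u mod M * int D"
        using assms by (simp add: minus_mod_eq_mult_div[symmetric])
      ultimately have "M * (u mod M * int D div M) < M * int D" by linarith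
      then have "u mod M * int D div M < int D" using assms by simp
      then show ?thesis using \<open>0 \<le> u mod M\<close> assms by (simp add: pos_imp_zdiv_nonneg_iff)
    qed
    then show ?thesis by (auto simp: g_def)
  qed
  moreover have "card ?B = D ^ r" by (simp add: card_PiE)
  moreover have "finite ?B" by (auto intro: finite_PiE)
  ultimately have "card (g ` {0..D ^ r}) \<le> D ^ r" by (metis card_mono)
  then have "\<not> inj_on g {0..D ^ r}" by (auto dest: card_image)
  then obtain j j' where "j \<le> D ^ r" "j' \<le> D ^ r" "j < j'" and g: "g j = g j'"
    by (auto simp: inj_on_def) (metis linorder_neqE_nat)
  show ?thesis
  proof (rule that[of "j' - j" "\<lambda>i. (int j' * x i) div M - (int j * x i) div M"])
    fix i assume i: "i < r"
    have "(int j' * x i) mod M * int D div M = (int j * x i) mod M * int D div M"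
      using fun_cong[OF g, of i] i by (simp add: g_def)
    from abs_diff_less_of_div_eq[OF assms(2) this]
    show "\<bar>int (j' - j) * x i - M * (int j' * x i div M - int j * x i div M)\<bar> * int D < M"
      using \<open>j < j'\<close> by (simp add: of_nat_diff algebra_simps minus_mult_div_eq_mod[symmetric])
  qed (use \<open>j < j'\<close> \<open>j' \<le> D ^ r\<close> in auto)
qed

text \<open>This is what a purely positive discrete length becomes on a commutative torsion-free
  subgroup: all pairs commute, so the triangle inequality is unconditional.\<close>

locale discrete_normed_group = comm_group A for A (structure) +
  fixes l :: "'a \<Rightarrow> real" and c :: real
  assumes norm_pow: "a \<in> carrier A \<Longrightarrow> l (a [^] (n::int)) = \<bar>real_of_int n\<bar> * l a"
    and norm_mult: "a \<in> carrier A \<Longrightarrow> b \<in> carrier A \<Longrightarrow> l (a \<otimes> b) \<le> l a + l b"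
    and const_pos: "c > 0"
    and norm_gt: "a \<in> carrier A \<Longrightarrow> a \<noteq> \<one> \<Longrightarrow> l a > c"
begin

lemma norm_one: "l \<one> = 0"
  using norm_pow[of \<one> 0] by simp

lemma norm_nonneg: "a \<in> carrier A \<Longrightarrow> l a \<ge> 0"
  using norm_gt[of a] const_pos norm_one by (cases "a = \<one>") auto

lemma norm_le_imp_one: "a \<in> carrier A \<Longrightarrow> l a \<le> c \<Longrightarrow> a = \<one>"
  using norm_gt[of a] by force

lemma pow_eq_one: "a \<in> carrier A \<Longrightarrow> a [^] (k::int) = \<one> \<Longrightarrow> k \<noteq> 0 \<Longrightarrow> a = \<one>"
  using norm_pow[of a k] norm_one norm_le_imp_one[of a] const_pos by simp

lemma pow_inject:
  assumes "a \<in> carrier A" "b \<in> carrier A" "a [^] (k::int) = b [^] k" "k \<noteq> 0"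
  shows "a = b"
proof -
  have "(a \<otimes> inv b) [^] k = \<one>"
    using assms by (simp add: int_pow_distrib int_pow_inv)
  then have "a \<otimes> inv b = \<one>" using pow_eq_one assms by simp
  then show ?thesis using assms by (metis inv_equality inv_inv inv_closed)
qed

lemma norm_comb_le:
  assumes "\<forall>i<r. e i \<in> carrier A" "\<And>i. i < r \<Longrightarrow> \<bar>real_of_int (x i)\<bar> \<le> m"
  shows "l (int_comb A e x r) \<le> m * (\<Sum>i<r. l (e i))"
  using assms
proof (induction r)
  case (Suc r)
  then have "l (int_comb A e x (Suc r)) \<le> l (int_comb A e x r) + \<bar>real_of_int (x r)\<bar> * l (e r)"
    using norm_mult[of "int_comb A e x r" "e r [^] x r"] by (simp add: norm_pow)
  moreover have "\<bar>real_of_int (x r)\<bar> * l (e r) \<le> m * l (e r)"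
    using Suc.prems norm_nonneg by (intro mult_right_mono) auto
  ultimately show ?case using Suc by (simp add: distrib_left)
qed (simp add: norm_one)

lemma sum_norm_nonneg: "\<forall>i<r. e i \<in> carrier A \<Longrightarrow> 0 \<le> (\<Sum>i<r. l (e i))"
  by (auto intro!: sum_nonneg norm_nonneg)

text \<open>Compactness of a sphere is not at hand, since positivity is only known at lattice
  points. Instead, let \<open>M\<close> be the largest absolute coordinate and suppose it is too
  large compared with the length. An integer vector \<open>z\<close> close to d x / M then has
  length at most \<open>c\<close> and so vanishes, although its entry at a largest coordinate of
  \<open>x\<close> is close to d or -d.\<close>

lemma coordinates_bounded_by_norm:
  assumes e: "int_independent A e r"
  obtains C where "C \<ge> 0" "\<And>x i. i < r \<Longrightarrow> \<bar>real_of_int (x i)\<bar> \<le> C * l (int_comb A e x r)"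
proof -
  note car = int_independent_carrier[OF e]
  define L where "L = (\<Sum>i<r. l (e i))"
  have L: "L \<ge> 0" unfolding L_def by (rule sum_norm_nonneg[OF car])
  \<comment> \<open>The mesh 1 / D is so fine that the rounding error, after division by
    \<open>M\<close>, costs at most c / 2. \<open>C\<close> is chosen below so that the contribution
    of up to \<open>D ^ r\<close> copies of the element costs at most c / 2 as well.\<close>
  define D where "D = Suc (nat \<lceil>2 * L / c\<rceil>)"
  have D: "D > 0" "2 * L \<le> c * real D"
  proof -
    have "2 * L / c \<le> real D" unfolding D_def by linarith
    then show "2 * L \<le> c * real D" using const_pos by (simp add: divide_le_eq mult.commute)
  qed (simp add: D_def)
  define C where "C = 2 * real (D ^ r) / c"
  have C: "C \<ge> 0" unfolding C_def using const_pos by simp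
  have "\<bar>real_of_int (x i)\<bar> \<le> C * l (int_comb A e x r)" if i: "i < r" for x i
  proof (rule ccontr)
    assume neg: "\<not> ?thesis"
    define M where "M = Max ((\<lambda>i. \<bar>x i\<bar>) ` {..<r})"
    have ub: "\<bar>x k\<bar> \<le> M" if "k < r" for k unfolding M_def using that by auto
    have "M \<in> (\<lambda>i. \<bar>x i\<bar>) ` {..<r}" unfolding M_def using i by (intro Max_in) auto
    then obtain k where k: "k < r" "M = \<bar>x k\<bar>" by auto
    let ?a = "int_comb A e x r"
    have a: "?a \<in> carrier A" using car by simp
    have big: "C * l ?a < real_of_int M" using neg ub[OF i] by linarith
    with C norm_nonneg[OF a] have M: "M > 0"
      by (metis mult_nonneg_nonneg of_int_0_less_iff le_less_trans)
    from simultaneous_approximation[OF D(1) M, of r x] obtain d z where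
      d: "0 < d" "d \<le> D ^ r" and z: "\<And>i. i < r \<Longrightarrow> \<bar>int d * x i - M * z i\<bar> * int D < M" by blast
    let ?z = "int_comb A e z r"
    have zc: "?z \<in> carrier A" using car by simp
    \<comment> \<open>The \<open>M\<close>-th power of \<open>?z\<close> is the \<open>d\<close>-th
      power of \<open>?a\<close> times a combination with coefficients of absolute value at most M /
      D.\<close>
    have "real_of_int M * l ?z = l (?z [^] M)" using norm_pow[OF zc] M by simp
    also have "?z [^] M = int_comb A e (\<lambda>i. int d * x i + (M * z i - int d * x i)) r"
      by (simp add: int_comb_pow[OF car])
    also have "\<dots> = ?a [^] int d \<otimes> int_comb A e (\<lambda>i. M * z i - int d * x i) r"
      by (simp only: int_comb_add[OF car] int_comb_pow[OF car])
    also have "l \<dots> \<le> real d * l ?a + l (int_comb A e (\<lambda>i. M * z i - int d * x i) r)"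
      using norm_mult[of "?a [^] int d" "int_comb A e (\<lambda>i. M * z i - int d * x i) r"] norm_pow[OF a, of "int d"] car
      by simp
    also have "l (int_comb A e (\<lambda>i. M * z i - int d * x i) r) \<le> real_of_int M / real D * L"
      unfolding L_def
    proof (rule norm_comb_le[OF car])
      fix i assume "i < r"
      from z[OF this] have "real_of_int (\<bar>M * z i - int d * x i\<bar> * int D) \<le> real_of_int M"
        by (subst of_int_le_iff) (simp add: abs_minus_commute)
      then show "\<bar>real_of_int (M * z i - int d * x i)\<bar> \<le> real_of_int M / real D"
        using D(1) by (simp add: le_divide_eq)
    qed
    also have "real_of_int M / real D * L \<le> real_of_int M * (c / 2)"
    proof -
      have "L / real D \<le> c / 2" using D by (simp add: divide_le_eq algebra_simps)
      then have "real_of_int M * (L / real D) \<le> real_of_int M * (c / 2)"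
        using M by (intro mult_left_mono) auto
      then show ?thesis by simp
    qed
    also have "real d * l ?a \<le> real (D ^ r) * l ?a"
      using d norm_nonneg[OF a] by (intro mult_right_mono) auto
    also have "real (D ^ r) * l ?a = (c / 2) * (C * l ?a)"
      unfolding C_def using const_pos by simp
    also have "\<dots> \<le> (c / 2) * real_of_int M"
      using big const_pos by (intro mult_left_mono) auto
    finally have "real_of_int M * l ?z \<le> real_of_int M * c" by (simp add: algebra_simps)
    then have "l ?z \<le> c" using M by simp
    then have "?z = \<one>" using norm_le_imp_one zc by simp
    \<comment> \<open>At the index \<open>k\<close> of a largest coordinate the approximation would
      read \<open>d * M * D < M\<close>.\<close>
    then have "z k = 0" using int_independentD[OF e] k by blast
    with z[OF k(1)] have "int d * M * int D < M" using k by (simp add: abs_mult)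
    moreover have "1 * M * 1 \<le> int d * M * int D"
      using d D M by (intro mult_mono) auto
    ultimately show False by simp
  qed
  with C that show ?thesis by blast
qed

text \<open>Multiplying the rational coordinates by \<open>D\<close> and rounding down takes
  finitely many values on a ball, by \<open>coordinates_bounded_by_norm\<close>. It is injective,
  because two elements with the same rounding differ by an element of length at most L / D, hence at
  most \<open>c\<close>.\<close>

lemma finite_balls:
  assumes "rational_basis A e r"
  shows "finite {a \<in> carrier A. l a \<le> R}"
proof -
  from assms have e: "int_independent A e r"
    and span: "\<forall>a\<in>carrier A. \<exists>k>0::int. \<exists>x. a [^] k = int_comb A e x r"
    by (auto simp: rational_basis_def)
  note car = int_independent_carrier[OF e]
  \<comment> \<open>The rational coordinates of \<open>a\<close> are
    \<open>x a i / k a\<close>.\<close>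
  from span obtain k x where kx: "\<And>a. a \<in> carrier A \<Longrightarrow> 0 < (k a :: int) \<and> a [^] k a = int_comb A e (x a) r"
    by metis
  from coordinates_bounded_by_norm[OF e] obtain C where
    C: "C \<ge> 0" "\<And>x i. i < r \<Longrightarrow> \<bar>real_of_int (x i)\<bar> \<le> C * l (int_comb A e x r)" by blast
  define L where "L = (\<Sum>i<r. l (e i))"
  have L: "L \<ge> 0" unfolding L_def by (rule sum_norm_nonneg[OF car])
  define D where "D = Suc (nat \<lceil>L / c\<rceil>)"
  have D: "D > 0" "L \<le> c * real D"
  proof -
    have "L / c \<le> real D" unfolding D_def by linarith
    then show "L \<le> c * real D" using const_pos by (simp add: divide_le_eq mult.commute)
  qed (simp add: D_def)
  define N where "N = \<lceil>real D * (C * R)\<rceil> + 1"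
  define g where "g = (\<lambda>a. \<lambda>i\<in>{..<r}. x a i * int D div k a)"
  let ?B = "{a \<in> carrier A. l a \<le> R}"
  have bound: "\<bar>x a i * int D div k a\<bar> \<le> N" if a: "a \<in> ?B" and i: "i < r" for a i
  proof -
    have k: "k a > 0" and eq: "a [^] k a = int_comb A e (x a) r" using kx a by auto
    have "\<bar>real_of_int (x a i)\<bar> \<le> C * l (a [^] k a)" using C(2)[OF i, of "x a"] eq by simp
    also have "\<dots> = C * real_of_int (k a) * l a" using norm_pow[of a "k a"] a k by simp
    also have "\<dots> \<le> C * real_of_int (k a) * R" using a C k by (intro mult_left_mono) auto
    finally have "\<bar>real_of_int (x a i)\<bar> / real_of_int (k a) \<le> C * R"
      using k by (simp add: divide_le_eq algebra_simps)
    then have "real D * (\<bar>real_of_int (x a i)\<bar> / real_of_int (k a)) \<le> real D * (C * R)"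
      by (intro mult_left_mono) auto
    then have "\<bar>real_of_int (x a i * int D) / real_of_int (k a)\<bar> \<le> real D * (C * R)"
      using k by (simp add: abs_mult mult.commute)
    then have "\<bar>\<lfloor>real_of_int (x a i * int D) / real_of_int (k a)\<rfloor>\<bar> \<le> N"
      unfolding N_def by linarith
    then show ?thesis by (simp only: floor_divide_of_int_eq)
  qed
  have "g ` ?B \<subseteq> PiE {..<r} (\<lambda>_. {-N..N})"
    using bound by (auto simp: g_def abs_le_iff) (smt (verit))+
  then have "finite (g ` ?B)" by (rule finite_subset) (auto intro: finite_PiE)
  moreover have "inj_on g ?B"
  proof (rule inj_onI)
    fix a b assume a: "a \<in> ?B" and b: "b \<in> ?B" and g: "g a = g b"
    \<comment> \<open>The coordinates of the difference of \<open>a\<close> and \<open>b\<close>,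
      with both denominators cleared.\<close>
    define u where "u = (\<lambda>i. k b * x a i - k a * x b i)"
    have k: "k a > 0" "k b > 0" using kx a b by auto
    let ?q = "a \<otimes> inv b"
    have qc: "?q \<in> carrier A" using a b by simp
    have "?q [^] (k a * k b) = (a [^] k a) [^] k b \<otimes> inv ((b [^] k b) [^] k a)"
      using a b by (simp add: int_pow_distrib int_pow_inv int_pow_pow mult.commute)
    also have "\<dots> = int_comb A e u r"
      unfolding u_def int_comb_diff[OF car] int_comb_pow[OF car] using kx a b by simp
    finally have q: "?q [^] (k a * k b) = int_comb A e u r" .
    have "l (int_comb A e u r) \<le> real_of_int (k a * k b) / real D * L"
      unfolding L_def
    proof (rule norm_comb_le[OF car])
      fix i assume i: "i < r"
      have "x a i * int D div k a = x b i * int D div k b"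
        using fun_cong[OF g, of i] i by (simp add: g_def)
      then have "(x a i * k b) * int D div (k a * k b) = (x b i * k a) * int D div (k a * k b)"
        using div_mult_mult1[of "k b" "x a i * int D" "k a"] div_mult_mult1[of "k a" "x b i * int D" "k b"] k
        by (simp add: ac_simps)
      from abs_diff_less_of_div_eq[OF _ this] k
      have "real_of_int (\<bar>u i\<bar> * int D) \<le> real_of_int (k a * k b)"
        unfolding u_def by (subst of_int_le_iff) (simp add: mult.commute)
      then show "\<bar>real_of_int (u i)\<bar> \<le> real_of_int (k a * k b) / real D"
        using D(1) by (simp add: le_divide_eq)
    qed
    also have "\<dots> = real_of_int (k a * k b) * (L / real D)" by simp
    also have "\<dots> \<le> real_of_int (k a * k b) * c"
      using D k by (intro mult_left_mono) (auto simp: divide_le_eq)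
    finally have "real_of_int (k a * k b) * l ?q \<le> real_of_int (k a * k b) * c"
      using norm_pow[OF qc, of "k a * k b"] q k by (simp add: abs_mult)
    then have "l ?q \<le> c" using k by (simp add: mult_le_cancel_left_pos)
    then have "?q = \<one>" using norm_le_imp_one qc by simp
    then show "a = b" using a b by (metis (lifting) inv_equality inv_inv inv_closed mem_Collect_eq)
  qed
  ultimately show ?thesis by (rule finite_imageD)
qed

text \<open>Taking the integer parts of the rational coordinates off an element leaves one with
  coordinates in [0, 1), which lies in the finite ball of radius \<open>L\<close>. So one
  denominator for each element of this ball suffices, and \<open>N\<close> is their product.\<close>

lemma bounded_exponent_mod_basis:
  assumes "rational_basis A e r"
  obtains N :: int where "N > 0" "\<And>a. a \<in> carrier A \<Longrightarrow> \<exists>x. a [^] N = int_comb A e x r"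
proof -
  from assms have e: "int_independent A e r"
    and span: "\<forall>a\<in>carrier A. \<exists>k>0::int. \<exists>x. a [^] k = int_comb A e x r"
    by (auto simp: rational_basis_def)
  note car = int_independent_carrier[OF e]
  from span obtain k x where kx: "\<And>a. a \<in> carrier A \<Longrightarrow> 0 < (k a :: int) \<and> a [^] k a = int_comb A e (x a) r"
    by metis
  define L where "L = (\<Sum>i<r. l (e i))"
  let ?B = "{a \<in> carrier A. l a \<le> L}"
  have fin: "finite ?B" using finite_balls[OF assms] .
  define N where "N = (\<Prod>b\<in>?B. k b)"
  show ?thesis
  proof (rule that[of N])
    show "N > 0" unfolding N_def by (rule prod_pos) (use kx in auto)
    fix a assume a: "a \<in> carrier A"
    have k: "k a > 0" and eq: "a [^] k a = int_comb A e (x a) r" using kx a by auto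
    let ?q = "int_comb A e (\<lambda>i. x a i div k a) r"
    define b where "b = a \<otimes> inv ?q"
    have b: "b \<in> carrier A" and q: "?q \<in> carrier A" unfolding b_def using a car by auto
    have "b [^] k a = int_comb A e (x a) r \<otimes> inv (?q [^] k a)"
      unfolding b_def using a q eq by (simp add: int_pow_distrib int_pow_inv)
    also have "\<dots> = int_comb A e (\<lambda>i. x a i - k a * (x a i div k a)) r"
      by (simp only: int_comb_diff[OF car] int_comb_pow[OF car])
    also have "\<dots> = int_comb A e (\<lambda>i. x a i mod k a) r"
      by (simp add: minus_mult_div_eq_mod)
    finally have "l (b [^] k a) \<le> real_of_int (k a) * L"
      unfolding L_def using norm_comb_le[OF car, of "\<lambda>i. x a i mod k a" "real_of_int (k a)"] k
      by (simp add: less_imp_le)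
    then have "l b \<le> L" using norm_pow[OF b, of "k a"] k by simp
    with b have bB: "b \<in> ?B" by simp
    then have "k b dvd N" unfolding N_def using fin by (intro dvd_prodI) auto
    then obtain m where m: "N = k b * m" by (auto elim: dvdE)
    have "a = b \<otimes> ?q" unfolding b_def using a q by (simp add: m_assoc)
    then have "a [^] N = (b \<otimes> ?q) [^] N" by simp
    also have "\<dots> = b [^] N \<otimes> ?q [^] N" using b q by (simp add: int_pow_distrib)
    also have "b [^] N = int_comb A e (x b) r [^] m"
      by (metis m kx[OF b] int_pow_pow[OF b] mult.commute)
    also have "int_comb A e (x b) r [^] m \<otimes> ?q [^] N
        = int_comb A e (\<lambda>i. m * x b i + N * (x a i div k a)) r"
      by (simp only: int_comb_add[OF car] int_comb_pow[OF car])
    finally show "\<exists>x. a [^] N = int_comb A e x r" by blast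
  qed
qed

text \<open>The \<open>N\<close>-th power map embeds \<open>A\<close> into the lattice spanned by
  \<open>e\<close>. Its image \<open>H\<close> has a basis, and the \<open>N\<close>-th roots of
  this basis form a basis of \<open>A\<close>.\<close>

theorem iso_integer_lattice:
  assumes "rank_le A n"
  shows "\<exists>s. A \<cong> product_group {..<s::nat} (\<lambda>_. integer_group)"
proof -
  obtain e r where er: "rational_basis A e r" using rank_le_imp_rational_basis[OF assms] .
  then have e: "int_independent A e r" by (simp add: rational_basis_def)
  from bounded_exponent_mod_basis[OF er] obtain N :: int where
    N: "N > 0" "\<And>a. a \<in> carrier A \<Longrightarrow> \<exists>x. a [^] N = int_comb A e x r" by blast
  define H where "H = (\<lambda>a. a [^] N) ` carrier A"
  have "subgroup H A"
  proof (rule subgroupI)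
    fix a b assume "a \<in> H" "b \<in> H"
    then obtain a' b' where "a = a' [^] N" "b = b' [^] N" "a' \<in> carrier A" "b' \<in> carrier A"
      by (auto simp: H_def)
    then have "a \<otimes> b = (a' \<otimes> b') [^] N" "a' \<otimes> b' \<in> carrier A" by (simp_all add: int_pow_distrib)
    then show "a \<otimes> b \<in> H" unfolding H_def by blast
  next
    fix a assume "a \<in> H"
    then obtain a' where "a = a' [^] N" "a' \<in> carrier A" by (auto simp: H_def)
    then have "inv a = (inv a') [^] N" "inv a' \<in> carrier A" by (simp_all add: int_pow_inv)
    then show "inv a \<in> H" unfolding H_def by blast
  qed (auto simp: H_def)
  moreover have "H \<subseteq> range (\<lambda>x. int_comb A e x r)" using N by (auto simp: H_def)
  ultimately obtain f s where f: "int_independent A f s" and H: "H = range (\<lambda>y. int_comb A f y s)"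
    using subgroup_of_span_has_basis[OF e] by blast
  have "\<exists>b. b \<in> carrier A \<and> f i = b [^] N" if "i < s" for i
  proof -
    have "f i = int_comb A f (\<lambda>j. if j = i then 1 else 0) s"
      using int_comb_unit[OF int_independent_carrier[OF f] that] by simp
    then have "f i \<in> H" using H by blast
    then show ?thesis by (auto simp: H_def)
  qed
  then obtain b where b: "\<And>i. i < s \<Longrightarrow> b i \<in> carrier A \<and> f i = b i [^] N" by metis
  then have car: "\<forall>i<s. b i \<in> carrier A" by auto
  have pow: "int_comb A f y s = int_comb A b y s [^] N" for y
    using int_comb_pow_base[OF car, of N y] int_comb_cong[of s f "\<lambda>i. b i [^] N" y y A] b by simp
  have "int_independent A b s"
    unfolding int_independent_def using car pow int_independentD[OF f] by auto
  moreover have "carrier A \<subseteq> range (\<lambda>y. int_comb A b y s)"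
  proof
    fix a assume a: "a \<in> carrier A"
    then have "a [^] N \<in> H" by (simp add: H_def)
    then obtain y where "a [^] N = int_comb A b y s [^] N" using H pow by auto
    then have "a = int_comb A b y s" using pow_inject[OF a] car N by simp
    then show "a \<in> range (\<lambda>y. int_comb A b y s)" by blast
  qed
  ultimately show ?thesis using basis_imp_iso by blast
qed

end

section \<open>Solvable groups with a discrete length function\<close>

context group
begin

section \<open>Subgroups of finite index\<close>

lemma finite_rcosetsI:
  assumes "subgroup H G" "finite (f ` carrier G)"
    and "\<And>g g'. g \<in> carrier G \<Longrightarrow> g' \<in> carrier G \<Longrightarrow> f g = f g' \<Longrightarrow> g \<otimes> inv g' \<in> H"
  shows "finite (rcosets H)"
proof -
  define p where "p = (\<lambda>t. H #> (SOME g. g \<in> carrier G \<and> f g = t))"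
  have "H #> g = p (f g)" if g: "g \<in> carrier G" for g
  proof -
    have ex: "\<exists>g'. g' \<in> carrier G \<and> f g' = f g" using g by blast
    define g' where "g' = (SOME g'. g' \<in> carrier G \<and> f g' = f g)"
    have g': "g' \<in> carrier G" "f g' = f g" using someI_ex[OF ex] by (auto simp: g'_def)
    then have "g \<otimes> inv g' \<in> H" using assms(3) g by simp
    then have "g \<in> H #> g'"
      using subgroup.rcos_module_rev[OF assms(1) is_group g'(1) g] by simp
    then have "H #> g' = H #> g" using repr_independence[OF _ g'(1) assms(1)] by simp
    then show ?thesis by (simp add: p_def g'_def)
  qed
  then have "rcosets H \<subseteq> p ` (f ` carrier G)" by (auto simp: RCOSETS_def)
  then show ?thesis using assms(2) finite_subset by blast
qed

lemma rcos_eq_imp_mem: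
  assumes "subgroup H G" "g \<in> carrier G" "g' \<in> carrier G" "H #> g = H #> g'"
  shows "g \<otimes> inv g' \<in> H"
  using subgroup.rcos_module_imp[OF assms(1) is_group assms(3), of g] rcos_self[OF assms(2,1)] assms(4)
  by simp

text \<open>The \<open>A\<close>-coset of \<open>g\<close> is determined by the
  \<open>K\<close>-coset of \<open>g\<close> and by the \<open>A\<close>-coset of
  \<open>g \<otimes> inv (t g)\<close>, where \<open>t g\<close> is a representative that depends
  only on the \<open>K\<close>-coset.\<close>

lemma finite_rcosets_trans:
  assumes K: "subgroup K G" "finite (rcosets K)"
    and A: "subgroup A (G\<lparr>carrier := K\<rparr>)" "finite (rcosets\<^bsub>G\<lparr>carrier := K\<rparr>\<^esub> A)"
  shows "finite (rcosets A)"
proof -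
  have AG: "subgroup A G" using incl_subgroup[OF K(1) A(1)] .
  define t where "t = (\<lambda>g. SOME h. h \<in> K #> g)"
  have t: "t g \<in> carrier G \<and> g \<otimes> inv (t g) \<in> K" if g: "g \<in> carrier G" for g
  proof -
    have "t g \<in> K #> g" unfolding t_def using rcos_self[OF g K(1)] by (rule someI)
    then have tg: "t g \<in> carrier G"
      using r_coset_subset_G[OF subgroup.subset[OF K(1)] g] by blast
    have "K #> g = K #> t g" using repr_independence[OF \<open>t g \<in> K #> g\<close> g K(1)] .
    then show ?thesis using rcos_eq_imp_mem[OF K(1) g tg] tg by simp
  qed
  define f where "f = (\<lambda>g. (K #> g, A #> (g \<otimes> inv (t g))))"
  show ?thesis
  proof (rule finite_rcosetsI[OF AG, of f])
    have "f ` carrier G \<subseteq> (rcosets K) \<times> (rcosets\<^bsub>G\<lparr>carrier := K\<rparr>\<^esub> A)"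
      using t by (auto simp: f_def RCOSETS_def r_coset_def)
    then show "finite (f ` carrier G)" using K A finite_subset by blast
  next
    fix g g' assume g: "g \<in> carrier G" "g' \<in> carrier G" "f g = f g'"
    then have eq: "K #> g = K #> g'" "A #> (g \<otimes> inv (t g)) = A #> (g' \<otimes> inv (t g'))"
      by (auto simp: f_def)
    then have tt: "t g' = t g" by (simp add: t_def)
    have "(g \<otimes> inv (t g)) \<otimes> inv (g' \<otimes> inv (t g)) \<in> A"
      using rcos_eq_imp_mem[OF AG _ _ eq(2)] t g tt by simp
    moreover have "(g \<otimes> inv (t g)) \<otimes> inv (g' \<otimes> inv (t g)) = g \<otimes> inv g'"
      using t[OF g(1)] g by (simp add: inv_mult_group m_assoc[symmetric]) (simp add: m_assoc)
    ultimately show "g \<otimes> inv g' \<in> A" by simp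
  qed
qed

lemma conj_mult:
  assumes "s \<in> carrier G" "x \<in> carrier G" "y \<in> carrier G"
  shows "s \<otimes> (x \<otimes> y) \<otimes> inv s = (s \<otimes> x \<otimes> inv s) \<otimes> (s \<otimes> y \<otimes> inv s)"
proof -
  have "inv s \<otimes> (s \<otimes> (y \<otimes> inv s)) = y \<otimes> inv s"
    using assms by (simp add: m_assoc[symmetric])
  then show ?thesis using assms by (simp add: m_assoc)
qed

lemma conj_inv:
  assumes "s \<in> carrier G" "x \<in> carrier G"
  shows "s \<otimes> inv x \<otimes> inv s = inv (s \<otimes> x \<otimes> inv s)"
  using assms by (simp add: inv_mult_group m_assoc)

lemma conj_conj:
  assumes "s \<in> carrier G" "t \<in> carrier G" "x \<in> carrier G"
  shows "s \<otimes> (t \<otimes> x \<otimes> inv t) \<otimes> inv s = (s \<otimes> t) \<otimes> x \<otimes> inv (s \<otimes> t)"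
  using assms by (simp add: inv_mult_group m_assoc)

text \<open>The intersection of all conjugates of \<open>A\<close> is the kernel of right
  multiplication on the finitely many cosets of \<open>A\<close>; \<open>f g\<close> records how
  \<open>g\<close> acts on them.\<close>

lemma finite_index_core:
  assumes A: "subgroup A G" "finite (rcosets A)"
  obtains N where "N \<lhd> G" "N \<subseteq> A" "finite (rcosets N)"
proof -
  interpret A: subgroup A G by fact
  define N where "N = {g \<in> carrier G. \<forall>s\<in>carrier G. s \<otimes> g \<otimes> inv s \<in> A}"
  have sub: "subgroup N G"
  proof (rule subgroupI)
    show "N \<noteq> {}" unfolding N_def using A.one_closed by (auto intro!: exI[of _ \<one>])
  next
    fix a assume "a \<in> N" then show "inv a \<in> N"
      unfolding N_def using conj_inv A.m_inv_closed by auto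
  next
    fix a b assume "a \<in> N" "b \<in> N" then show "a \<otimes> b \<in> N"
      unfolding N_def using conj_mult A.m_closed by auto
  qed (auto simp: N_def)
  have nor: "N \<lhd> G"
    unfolding normal_inv_iff
  proof (intro conjI sub ballI)
    fix x h assume "x \<in> carrier G" "h \<in> N"
    then show "x \<otimes> h \<otimes> inv x \<in> N" unfolding N_def using conj_conj by auto
  qed
  have NA: "N \<subseteq> A"
  proof
    fix g assume "g \<in> N"
    then have "g \<in> carrier G" "\<one> \<otimes> g \<otimes> inv \<one> \<in> A" unfolding N_def by blast+
    then show "g \<in> A" by simp
  qed
  define f where "f = (\<lambda>g. \<lambda>C\<in>rcosets A. C #> g)"
  have cos: "(A #> s) #> g = A #> (s \<otimes> g)" if "s \<in> carrier G" "g \<in> carrier G" for s g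
    using coset_mult_assoc[OF A.subset that] .
  have "finite (rcosets N)"
  proof (rule finite_rcosetsI[OF sub, of f])
    have "C #> g \<in> rcosets A" if "C \<in> rcosets A" "g \<in> carrier G" for C g
      using that cos by (auto simp: RCOSETS_def)
    then have "f ` carrier G \<subseteq> PiE (rcosets A) (\<lambda>_. rcosets A)" by (auto simp: f_def)
    then show "finite (f ` carrier G)" using A(2) finite_PiE[OF A(2), of "\<lambda>_. rcosets A"] finite_subset by blast
  next
    fix g g' assume g: "g \<in> carrier G" "g' \<in> carrier G" "f g = f g'"
    show "g \<otimes> inv g' \<in> N" unfolding N_def
    proof (intro CollectI conjI ballI)
      fix s assume s: "s \<in> carrier G"
      then have "A #> s \<in> rcosets A" by (auto simp: RCOSETS_def)
      with fun_cong[OF g(3), of "A #> s"] have "A #> (s \<otimes> g) = A #> (s \<otimes> g')"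
        using cos s g by (simp add: f_def)
      then have "(s \<otimes> g) \<otimes> inv (s \<otimes> g') \<in> A"
        using rcos_eq_imp_mem[OF A(1)] s g by simp
      then show "s \<otimes> (g \<otimes> inv g') \<otimes> inv s \<in> A"
        using s g by (simp add: inv_mult_group m_assoc)
    qed (use g in simp)
  qed
  with nor NA that show ?thesis by blast
qed

section \<open>Commutators and self-centralising subgroups\<close>

lemma length_function_subgroup:
  assumes "length_function G l" "subgroup H G"
  shows "length_function (G\<lparr>carrier := H\<rparr>) l"
  using assms(1) subgroup.mem_carrier[OF assms(2)]
  by (simp add: length_function_def int_pow_consistent[OF assms(2), symmetric]
      m_inv_consistent[OF assms(2)])

text \<open>If \<open>z = [a, b]\<close> commutes with \<open>a\<close> and \<open>b\<close>, then \<open>z\<^sup>k b\<close> is conjugate to \<open>b\<close>,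
  so the length of \<open>z\<^sup>k\<close> is at most twice that of \<open>b\<close> for all \<open>k\<close>.\<close>

lemma commute_of_central_commutator:
  assumes l: "length_function G l" and pos: "\<And>g. g \<in> carrier G \<Longrightarrow> g \<noteq> \<one> \<Longrightarrow> l g > 0"
    and ab: "a \<in> carrier G" "b \<in> carrier G"
    and z: "z = a \<otimes> b \<otimes> inv a \<otimes> inv b" "z \<otimes> a = a \<otimes> z" "z \<otimes> b = b \<otimes> z"
  shows "a \<otimes> b = b \<otimes> a"
proof -
  have zc: "z \<in> carrier G" using ab z by simp
  have aba: "a \<otimes> b \<otimes> inv a = z \<otimes> b" using ab z by (simp add: m_assoc)
  have comm: "z [^] k \<otimes> y = y \<otimes> z [^] k" if "y \<in> carrier G" "z \<otimes> y = y \<otimes> z" for k :: nat and y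
    using group_commutes_pow[OF that(2) zc that(1)] by simp
  have conj: "a [^] k \<otimes> b \<otimes> inv (a [^] k) = z [^] k \<otimes> b" for k :: nat
  proof (induction k)
    case (Suc k)
    have "a [^] Suc k = a \<otimes> a [^] k"
      using ab by (metis nat_pow_Suc2)
    then have "a [^] Suc k \<otimes> b \<otimes> inv (a [^] Suc k) = a \<otimes> (a [^] k \<otimes> b \<otimes> inv (a [^] k)) \<otimes> inv a"
      using conj_conj[of a "a [^] k" b] ab by simp
    also have "\<dots> = (a \<otimes> z [^] k) \<otimes> b \<otimes> inv a"
      using Suc ab zc by (simp add: m_assoc)
    also have "a \<otimes> z [^] k = z [^] k \<otimes> a" using comm[OF ab(1) z(2)] by simp
    also have "z [^] k \<otimes> a \<otimes> b \<otimes> inv a = z [^] k \<otimes> (a \<otimes> b \<otimes> inv a)"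
      using ab zc by (simp add: m_assoc)
    also have "\<dots> = z [^] Suc k \<otimes> b" unfolding aba using ab zc by (simp add: m_assoc)
    finally show ?case .
  qed (use ab in simp)
  have bound: "real k * l z \<le> 2 * l b" for k :: nat
  proof -
    have "l (z [^] k \<otimes> b) = l b"
      using l ab by (metis conj length_function_def nat_pow_closed)
    \<comment> \<open>The triangle inequality needs commuting factors:
      \<open>z [^] k \<otimes> b\<close> commutes with \<open>inv b\<close> because \<open>z\<close>
      commutes with \<open>b\<close>.\<close>
    moreover have "l (z [^] k) \<le> l (z [^] k \<otimes> b) + l (inv b)"
    proof -
      have "(z [^] k \<otimes> b) \<otimes> inv b = z [^] k" using ab zc by (simp add: m_assoc)
      moreover have "inv b \<otimes> (z [^] k \<otimes> b) = z [^] k"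
        using comm[OF ab(2) z(3)] ab zc by (simp add: m_assoc[symmetric])
      moreover have "z [^] k \<otimes> b \<in> carrier G" "inv b \<in> carrier G" using ab zc by auto
      ultimately show ?thesis using l unfolding length_function_def by metis
    qed
    moreover have "l (inv b) = l b"
    proof -
      have "l (b [^] (-1::int)) = \<bar>real_of_int (-1)\<bar> * l b"
        using l ab unfolding length_function_def by blast
      then show ?thesis using ab by (simp add: int_pow_neg)
    qed
    moreover have "l (z [^] k) = real k * l z"
    proof -
      have "l (z [^] int k) = \<bar>real_of_int (int k)\<bar> * l z"
        using l zc unfolding length_function_def by blast
      then show ?thesis by (simp add: int_pow_int)
    qed
    ultimately show ?thesis by simp
  qed
  have "\<not> l z > 0"
    using bound reals_Archimedean3 by (metis not_le)
  then have "z = \<one>" using pos zc by blast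
  then have "a \<otimes> b \<otimes> inv a = b" using aba ab by simp
  then show ?thesis using ab by (metis inv_solve_right m_closed)
qed

lemma normal_exp_of_derived: "(derived G ^^ k) (carrier G) \<lhd> G"
  by (induction k) (auto intro: normal_self derived_is_normal)

text \<open>Take a maximal commuting conjugation-invariant set \<open>M\<close> with centraliser
  \<open>Z\<close>. Going down in \<open>k\<close>, the intersection of \<open>Z\<close> with the
  \<open>k\<close>-th derived subgroup lies in \<open>M\<close>: commutators of its elements lie in
  the next such intersection, hence in \<open>M\<close>, hence commute with \<open>Z\<close> and are
  trivial. So this intersection is commutative, and maximality absorbs it. At \<open>k = 0\<close>
  this gives \<open>Z = M\<close>.\<close>

lemma self_centralizing_subgroup:
  assumes "solvable G"
    and l: "length_function G l" and pos: "\<And>g. g \<in> carrier G \<Longrightarrow> g \<noteq> \<one> \<Longrightarrow> l g > 0"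
  obtains M where "M \<lhd> G" "M = {g \<in> carrier G. \<forall>x\<in>M. g \<otimes> x = x \<otimes> g}"
proof -
  \<comment> \<open>Plain sets rather than subgroups, so that the union of two good sets commuting
    with each other is good. That \<open>M\<close> is a subgroup follows in the end from
    \<open>M = Z\<close>.\<close>
  define good where "good = (\<lambda>U. U \<subseteq> carrier G \<and> (\<forall>x\<in>U. \<forall>y\<in>U. x \<otimes> y = y \<otimes> x) \<and>
     (\<forall>g\<in>carrier G. \<forall>x\<in>U. g \<otimes> x \<otimes> inv g \<in> U))"
  have "\<exists>M\<in>Collect good. \<forall>U\<in>Collect good. M \<subseteq> U \<longrightarrow> U = M"
  proof (rule Zorn_Lemma, rule ballI)
    fix C assume C: "C \<in> chains (Collect good)"
    then have g: "good U" if "U \<in> C" for U using that chainsD2 by blast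
    have "x \<otimes> y = y \<otimes> x" if xy: "x \<in> U" "U \<in> C" "y \<in> Y" "Y \<in> C" for x y U Y
      using chainsD[OF C xy(2,4)] g[OF xy(2)] g[OF xy(4)] xy unfolding good_def by blast
    moreover have "U \<subseteq> carrier G" if "U \<in> C" for U using g[OF that] by (simp add: good_def)
    then have "\<Union> C \<subseteq> carrier G" by (rule Union_least)
    moreover have "h \<otimes> x \<otimes> inv h \<in> \<Union> C" if "h \<in> carrier G" "x \<in> \<Union> C" for h x
    proof -
      from that(2) obtain U where U: "U \<in> C" "x \<in> U" by blast
      have "h \<otimes> x \<otimes> inv h \<in> U" using g[OF U(1)] U(2) that(1) by (simp add: good_def)
      with U show ?thesis by blast
    qed
    ultimately have "good (\<Union> C)" unfolding good_def by (simp add: Ball_def) blast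
    then show "\<Union> C \<in> Collect good" by simp
  qed
  then obtain M where M: "good M" and max: "\<And>U. good U \<Longrightarrow> M \<subseteq> U \<Longrightarrow> U = M" by blast
  have Mc: "M \<subseteq> carrier G" and Mcomm: "\<And>x y. x \<in> M \<Longrightarrow> y \<in> M \<Longrightarrow> x \<otimes> y = y \<otimes> x"
    and Mconj: "\<And>g x. g \<in> carrier G \<Longrightarrow> x \<in> M \<Longrightarrow> g \<otimes> x \<otimes> inv g \<in> M"
    using M by (auto simp: good_def)
  define Z where "Z = {g \<in> carrier G. \<forall>x\<in>M. g \<otimes> x = x \<otimes> g}"
  have Zcomm: "z \<otimes> x = x \<otimes> z" if "z \<in> Z" "x \<in> M" for z x using that by (simp add: Z_def)
  have absorb: "Y \<subseteq> M" if "good Y" "Y \<subseteq> Z" for Y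
  proof -
    have "good (M \<union> Y)"
      unfolding good_def
    proof (intro conjI ballI)
      show "M \<union> Y \<subseteq> carrier G" using that(1) Mc by (auto simp: good_def)
    next
      fix x y assume "x \<in> M \<union> Y" "y \<in> M \<union> Y"
      moreover have "x \<otimes> y = y \<otimes> x" if "x \<in> Y" "y \<in> Y" for x y
        using that \<open>good Y\<close> by (auto simp: good_def)
      moreover have "x \<otimes> y = y \<otimes> x" if "x \<in> Y" "y \<in> M" for x y
        using that \<open>Y \<subseteq> Z\<close> by (auto simp: Z_def)
      ultimately show "x \<otimes> y = y \<otimes> x" using Mcomm by (metis UnE)
    next
      fix g x assume "g \<in> carrier G" "x \<in> M \<union> Y"
      then show "g \<otimes> x \<otimes> inv g \<in> M \<union> Y" using Mconj that(1) by (auto simp: good_def)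
    qed
    from max[OF this] show ?thesis by blast
  qed
  have subZ: "subgroup Z G"
  proof (rule subgroupI)
    show "Z \<noteq> {}" unfolding Z_def using Mc by (auto intro!: exI[of _ \<one>])
  next
    fix a assume a: "a \<in> Z"
    show "inv a \<in> Z" unfolding Z_def
    proof (intro CollectI conjI ballI)
      fix x assume "x \<in> M"
      then have "a \<otimes> x = x \<otimes> a" "x \<in> carrier G" "a \<in> carrier G" using a Mc by (auto simp: Z_def)
      then have "inv a \<otimes> (a \<otimes> x) \<otimes> inv a = inv a \<otimes> (x \<otimes> a) \<otimes> inv a"
        and c: "x \<in> carrier G" "a \<in> carrier G" by auto
      moreover have "inv a \<otimes> (a \<otimes> x) \<otimes> inv a = x \<otimes> inv a"
        using c by (simp add: m_assoc[symmetric])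
      moreover have "inv a \<otimes> (x \<otimes> a) \<otimes> inv a = inv a \<otimes> x"
        using c by (simp add: m_assoc)
      ultimately show "inv a \<otimes> x = x \<otimes> inv a" by simp
    qed (use a in \<open>simp add: Z_def\<close>)
  next
    fix a b assume ab: "a \<in> Z" "b \<in> Z"
    show "a \<otimes> b \<in> Z" unfolding Z_def
    proof (intro CollectI conjI ballI)
      fix x assume "x \<in> M"
      then have "a \<otimes> x = x \<otimes> a" "b \<otimes> x = x \<otimes> b" "x \<in> carrier G" "a \<in> carrier G" "b \<in> carrier G"
        using ab Mc by (auto simp: Z_def)
      then show "a \<otimes> b \<otimes> x = x \<otimes> (a \<otimes> b)" by (metis m_assoc)
    qed (use ab in \<open>simp add: Z_def\<close>)
  qed (auto simp: Z_def)
  have Zconj: "g \<otimes> z \<otimes> inv g \<in> Z" if g: "g \<in> carrier G" and z: "z \<in> Z" for g z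
    unfolding Z_def
  proof (intro CollectI conjI ballI)
    show "g \<otimes> z \<otimes> inv g \<in> carrier G" using g z by (simp add: Z_def)
    fix x assume x: "x \<in> M"
    define y where "y = inv g \<otimes> x \<otimes> g"
    have y: "y \<in> M" using Mconj[of "inv g" x] g x by (simp add: y_def)
    have xc: "x \<in> carrier G" and yc: "y \<in> carrier G" and zc: "z \<in> carrier G" and zy: "z \<otimes> y = y \<otimes> z"
      using x y z Mc by (auto simp: Z_def)
    have xy: "x = g \<otimes> y \<otimes> inv g" unfolding y_def using g xc
      by (simp add: m_assoc[symmetric]) (simp add: m_assoc)
    show "g \<otimes> z \<otimes> inv g \<otimes> x = x \<otimes> (g \<otimes> z \<otimes> inv g)"
      unfolding xy conj_mult[OF g zc yc, symmetric] conj_mult[OF g yc zc, symmetric] zy ..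
  qed
  have "{\<one>} \<subseteq> M"
    by (rule absorb) (use Mc in \<open>auto simp: good_def Z_def\<close>)
  obtain n where n: "(derived G ^^ n) (carrier G) = {\<one>}"
    using assms(1) solvable_iff_trivial_derived_seq by blast
  \<comment> \<open>Descending induction on the exponent, by truncated subtraction: from
    \<open>j = n\<close> on the exponent stays 0.\<close>
  have "(derived G ^^ (n - j)) (carrier G) \<inter> Z \<subseteq> M" for j
  proof (induction j)
    case 0
    then show ?case using n \<open>{\<one>} \<subseteq> M\<close> by auto
  next
    case (Suc j)
    show ?case
    proof (cases "j < n")
      case True
      define k where "k = n - Suc j"
      have k: "n - j = Suc k" using True by (simp add: k_def)
      let ?Y = "(derived G ^^ k) (carrier G) \<inter> Z"
      have nor: "(derived G ^^ k) (carrier G) \<lhd> G" by (rule normal_exp_of_derived)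
      have "?Y \<subseteq> M"
      proof (rule absorb)
        show "good ?Y" unfolding good_def
        proof (intro conjI ballI)
          show "?Y \<subseteq> carrier G" by (auto simp: Z_def)
        next
          fix g x assume "g \<in> carrier G" "x \<in> ?Y"
          then show "g \<otimes> x \<otimes> inv g \<in> ?Y" using Zconj normal.inv_op_closed2[OF nor] by blast
        next
          fix a b assume a: "a \<in> ?Y" and b: "b \<in> ?Y"
          let ?z = "a \<otimes> b \<otimes> inv a \<otimes> inv b"
          have "?z \<in> derived G ((derived G ^^ k) (carrier G))"
            unfolding derived_def[of G "(derived G ^^ k) (carrier G)"]
            by (rule generate.incl) (use a b in auto)
          moreover have "?z \<in> Z"
            using a b subZ by (simp add: subgroup.m_closed subgroup.m_inv_closed)
          ultimately have "?z \<in> M" using Suc k by auto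
          show "a \<otimes> b = b \<otimes> a"
          proof (rule commute_of_central_commutator[OF l])
            show "?z \<otimes> a = a \<otimes> ?z" by (rule Zcomm[symmetric]) (use a \<open>?z \<in> M\<close> in blast)+
            show "?z \<otimes> b = b \<otimes> ?z" by (rule Zcomm[symmetric]) (use b \<open>?z \<in> M\<close> in blast)+
          qed (use pos a b in \<open>auto simp: Z_def\<close>)
        qed
      qed blast
      then show ?thesis by (simp add: k_def)
    next
      case False then show ?thesis using Suc by simp
    qed
  qed
  from this[of n] have "Z \<subseteq> M" by (auto simp: Z_def)
  moreover have "M \<subseteq> Z" using Mc Mcomm by (auto simp: Z_def)
  ultimately have MZ: "M = Z" by simp
  have "M \<lhd> G" unfolding normal_inv_iff using subZ Mconj by (auto simp: MZ)
  then show ?thesis using that[of M] MZ unfolding Z_def by blast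
qed

lemma discrete_normed_subgroup:
  assumes l: "length_function G l" and c: "c > 0" "\<And>g. g \<in> carrier G \<Longrightarrow> g \<noteq> \<one> \<Longrightarrow> l g > c"
    and A: "subgroup A G" "\<And>x y. x \<in> A \<Longrightarrow> y \<in> A \<Longrightarrow> x \<otimes> y = y \<otimes> x"
  shows "discrete_normed_group (G\<lparr>carrier := A\<rparr>) l c"
proof -
  interpret A: group "G\<lparr>carrier := A\<rparr>" using subgroup.subgroup_is_group[OF A(1) is_group] .
  interpret comm_group "G\<lparr>carrier := A\<rparr>" by (rule A.group_comm_groupI) (simp add: A)
  show ?thesis
    using length_function_subgroup[OF l A(1)] c subgroup.mem_carrier[OF A(1)] A(2)
    by unfold_locales (auto simp: length_function_def)
qed

text \<open>An element acting trivially on the ball commutes with a rational basis of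
  \<open>A\<close>, hence with all of \<open>A\<close> because roots in \<open>A\<close> are unique.
  As \<open>A\<close> is its own centraliser, such an element lies in \<open>A\<close>.\<close>

theorem virtually_abelian:
  assumes "solvable G" and l: "length_function G l"
    and c: "c > 0" "\<And>g. g \<in> carrier G \<Longrightarrow> g \<noteq> \<one> \<Longrightarrow> l g > c"
    and rank: "\<And>A. subgroup A G \<Longrightarrow> comm_group (G\<lparr>carrier := A\<rparr>) \<Longrightarrow> rank_le (G\<lparr>carrier := A\<rparr>) n"
  obtains A where "subgroup A G" "\<And>x y. x \<in> A \<Longrightarrow> y \<in> A \<Longrightarrow> x \<otimes> y = y \<otimes> x" "finite (rcosets A)"
proof -
  have pos: "l g > 0" if "g \<in> carrier G" "g \<noteq> \<one>" for g
    using c(2)[OF that] c(1) by simp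
  obtain A where nor: "A \<lhd> G" and A: "A = {g \<in> carrier G. \<forall>x\<in>A. g \<otimes> x = x \<otimes> g}"
    using self_centralizing_subgroup[OF assms(1) l pos] by blast
  have sub: "subgroup A G" using nor by (rule normal_imp_subgroup)
  have comm: "x \<otimes> y = y \<otimes> x" if "x \<in> A" "y \<in> A" for x y using A that by blast
  let ?A = "G\<lparr>carrier := A\<rparr>"
  interpret A: discrete_normed_group ?A l c
    by (rule discrete_normed_subgroup[OF l c sub comm])
  have car: "x \<in> carrier G" if "x \<in> A" for x using subgroup.mem_carrier[OF sub that] .
  have "rank_le ?A n" by (rule rank[OF sub]) unfold_locales
  then obtain e r where er: "rational_basis ?A e r" using A.rank_le_imp_rational_basis by blast
  then have e: "int_independent ?A e r" by (simp add: rational_basis_def)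
  have eA: "\<forall>i<r. e i \<in> A" using A.int_independent_carrier[OF e] by simp
  \<comment> \<open>The radius is large enough for every \<open>e i\<close> to lie in
    \<open>B\<close>. Conjugation preserves \<open>B\<close> because \<open>A\<close> is normal and
    \<open>l\<close> is constant on conjugacy classes.\<close>
  define B where "B = {a \<in> A. l a \<le> (\<Sum>i<r. l (e i))}"
  have finB: "finite B" using A.finite_balls[OF er] by (simp add: B_def)
  have eB: "e i \<in> B" if "i < r" for i
    unfolding B_def using eA that pos car A.norm_nonneg by (auto intro!: member_le_sum)
  \<comment> \<open>With the inverse on the left, \<open>f g = f g'\<close> says that
    \<open>g \<otimes> inv g'\<close> commutes with every element of \<open>B\<close>, which is the
    form needed for right cosets.\<close>
  define f where "f = (\<lambda>g. \<lambda>a\<in>B. inv g \<otimes> a \<otimes> g)"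
  have "finite (rcosets A)"
  proof (rule finite_rcosetsI[OF sub, of f])
    have "inv g \<otimes> a \<otimes> g \<in> B" if "g \<in> carrier G" "a \<in> B" for g a
    proof -
      have aA: "a \<in> A" using that by (simp add: B_def)
      have "l (inv g \<otimes> a \<otimes> inv (inv g)) = l a"
        using l that(1) car[OF aA] unfolding length_function_def by (metis inv_closed)
      then show ?thesis using that normal.inv_op_closed1[OF nor] by (simp add: B_def)
    qed
    then have "f ` carrier G \<subseteq> PiE B (\<lambda>_. B)" by (auto simp: f_def)
    then show "finite (f ` carrier G)" using finite_PiE[OF finB, of "\<lambda>_. B"] finB finite_subset by blast
  next
    fix g g' assume g: "g \<in> carrier G" "g' \<in> carrier G" "f g = f g'"
    define u where "u = g \<otimes> inv g'"
    have u: "u \<in> carrier G" using g by (simp add: u_def)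
    have ue: "e i \<otimes> u = u \<otimes> e i" if i: "i < r" for i
    proof -
      have ec: "e i \<in> carrier G" using eA i car by blast
      have "inv g \<otimes> e i \<otimes> g = inv g' \<otimes> e i \<otimes> g'"
        using fun_cong[OF g(3), of "e i"] eB[OF i] by (simp add: f_def)
      then have "g \<otimes> (inv g \<otimes> e i \<otimes> g) \<otimes> inv g' = g \<otimes> (inv g' \<otimes> e i \<otimes> g') \<otimes> inv g'" by simp
      moreover have "g \<otimes> (inv g \<otimes> e i \<otimes> g) \<otimes> inv g' = e i \<otimes> u"
        unfolding u_def using g ec by (simp add: m_assoc[symmetric])
      moreover have "g \<otimes> (inv g' \<otimes> e i \<otimes> g') \<otimes> inv g' = u \<otimes> e i"
        unfolding u_def using g ec by (simp add: m_assoc)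
      ultimately show ?thesis by simp
    qed
    have conj: "inv u \<otimes> a \<otimes> u = a \<longleftrightarrow> a \<otimes> u = u \<otimes> a" if "a \<in> carrier G" for a
      using that u inv_solve_left[of a u "a \<otimes> u"] by (auto simp: m_assoc)
    let ?h = "\<lambda>a. inv u \<otimes> a \<otimes> u"
    have hom: "?h \<in> hom ?A ?A"
    proof (rule homI)
      fix x y assume "x \<in> carrier ?A" "y \<in> carrier ?A"
      then show "?h (x \<otimes>\<^bsub>?A\<^esub> y) = ?h x \<otimes>\<^bsub>?A\<^esub> ?h y"
        using conj_mult[of "inv u" x y] u car by simp
    qed (use normal.inv_op_closed1[OF nor u] in simp)
    interpret h: group_hom ?A ?A ?h by unfold_locales (rule hom)
    have fix_comb: "?h (int_comb ?A e x s) = int_comb ?A e x s" if "s \<le> r" for x s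
      using that
    proof (induction s)
      case 0
      then show ?case using u by simp
    next
      case (Suc s)
      have es: "e s \<in> A" "?h (e s) = e s" using eA Suc.prems conj ue car by auto
      have cA: "int_comb ?A e x s \<in> carrier ?A" using eA Suc.prems by (intro A.int_comb_closed) auto
      have "?h (int_comb ?A e x (Suc s)) = ?h (int_comb ?A e x s) \<otimes>\<^bsub>?A\<^esub> ?h (e s [^]\<^bsub>?A\<^esub> x s)"
        unfolding int_comb.simps by (rule h.hom_mult) (use cA es A.int_pow_closed in auto)
      also have "?h (e s [^]\<^bsub>?A\<^esub> x s) = ?h (e s) [^]\<^bsub>?A\<^esub> x s"
        by (rule h.hom_int_pow) (use es in simp)
      finally show ?case using Suc es by simp
    qed
    have "u \<otimes> a = a \<otimes> u" if a: "a \<in> A" for a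
    proof -
      obtain k x where k: "(k::int) > 0" "a [^]\<^bsub>?A\<^esub> k = int_comb ?A e x r"
        using er a by (auto simp: rational_basis_def)
      have "?h a [^]\<^bsub>?A\<^esub> k = ?h (a [^]\<^bsub>?A\<^esub> k)"
        by (rule h.hom_int_pow[symmetric]) (use a in simp)
      also have "\<dots> = a [^]\<^bsub>?A\<^esub> k" unfolding k using fix_comb by simp
      finally have "?h a = a"
        using A.pow_inject[of "?h a" a k] k a normal.inv_op_closed1[OF nor u] by simp
      then show ?thesis using conj car a by simp
    qed
    then show "g \<otimes> inv g' \<in> A" using A u unfolding u_def by blast
  qed
  with sub comm that show ?thesis by blast
qed

end

section \<open>Cohomology with coefficients of any size\<close>

lemma tl_tuples: "gs \<in> tuples K (Suc n) \<Longrightarrow> tl gs \<in> tuples K n"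
  by (cases gs) (auto simp: tuples_def)

lemma take_tuples: "gs \<in> tuples K (Suc n) \<Longrightarrow> take n gs \<in> tuples K n"
  by (auto simp: tuples_def dest: in_set_takeD)

lemma nth_tuples: "gs \<in> tuples K n \<Longrightarrow> i < n \<Longrightarrow> gs ! i \<in> carrier K"
  by (auto simp: tuples_def)

lemma length_tuples: "gs \<in> tuples K n \<Longrightarrow> length gs = n"
  by (simp add: tuples_def)

lemma (in group) merge_at_tuples:
  assumes "gs \<in> tuples G (Suc n)" "i \<in> {1..n}"
  shows "merge_at G i gs \<in> tuples G n"
  using assms nth_tuples[OF assms(1), of "i - 1"] nth_tuples[OF assms(1), of i]
  by (auto simp: tuples_def merge_at_def dest: in_set_takeD in_set_dropD)

text \<open>The index \<open>i\<close> counts entries from 1 and \<open>!\<close> counts from 0, so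
  the merged product sits at position \<open>i - 1\<close>.\<close>

lemma merge_at_nth:
  assumes "length gs = Suc n" "i \<in> {1..n}" "j < n"
  shows "merge_at K i gs ! j =
    (if Suc j < i then gs ! j else if Suc j = i then gs ! (i - 1) \<otimes>\<^bsub>K\<^esub> gs ! i else gs ! Suc j)"
  using assms by (auto simp: merge_at_def nth_append min_def nth_Cons' intro!: arg_cong[of _ _ "(!) gs"])

lemma hom_finprod:
  assumes "comm_group M" "comm_group M'" "h \<in> hom M M'" "finite I" "\<And>i. i \<in> I \<Longrightarrow> F i \<in> carrier M"
  shows "h (finprod M F I) = finprod M' (\<lambda>i. h (F i)) I"
proof -
  interpret M: comm_group M by fact
  interpret M': comm_group M' by fact
  have h1: "h \<one>\<^bsub>M\<^esub> = \<one>\<^bsub>M'\<^esub>" using hom_one[OF assms(3)] M.is_group M'.is_group by simp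
  show ?thesis
    using assms(4,5)
  proof (induction I rule: finite_induct)
    case (insert i I)
    then have "F \<in> I \<rightarrow> carrier M" "F i \<in> carrier M" by auto
    moreover from this have "(\<lambda>i. h (F i)) \<in> I \<rightarrow> carrier M'" "h (F i) \<in> carrier M'"
      using hom_in_carrier[OF assms(3)] by auto
    ultimately show ?case using insert by (simp add: hom_mult[OF assms(3)])
  qed (simp add: h1)
qed

text \<open>Each operation in the coboundary commutes with an equivariant homomorphism of
  coefficients. The cochains need to correspond on tuples only.\<close>

lemma coboundary_hom:
  assumes K: "group K" and M: "comm_group M" "\<And>g m. g \<in> carrier K \<Longrightarrow> m \<in> carrier M \<Longrightarrow> act g m \<in> carrier M"
    and M': "comm_group M'"
    and h: "h \<in> hom M M'" "\<And>g m. g \<in> carrier K \<Longrightarrow> m \<in> carrier M \<Longrightarrow> h (act g m) = act' g (h m)"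
    and f: "cochain K M n f" "\<And>gs. gs \<in> tuples K n \<Longrightarrow> f' gs = h (f gs)"
    and gs: "gs \<in> tuples K (Suc n)"
  shows "coboundary K M' act' n f' gs = h (coboundary K M act n f gs)"
    and "coboundary K M act n f gs \<in> carrier M"
proof -
  interpret M: comm_group M by fact
  interpret M': comm_group M' by fact
  have f_closed: "f t \<in> carrier M" if "t \<in> tuples K n" for t
    using f(1) that by (simp add: cochain_def)
  note g0 = nth_tuples[OF gs, of 0, simplified]
  note mg = group.merge_at_tuples[OF K gs]
  have pow: "h (f t [^]\<^bsub>M\<^esub> k) = f' t [^]\<^bsub>M'\<^esub> k" if "t \<in> tuples K n" for t and k :: int
    using hom_int_pow[OF h(1) f_closed[OF that] M.is_group M'.is_group] f(2)[OF that] by simp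
  let ?F = "\<lambda>i. f (merge_at K i gs) [^]\<^bsub>M\<^esub> ((-1::int) ^ i)"
  let ?F' = "\<lambda>i. f' (merge_at K i gs) [^]\<^bsub>M'\<^esub> ((-1::int) ^ i)"
  have F: "?F i \<in> carrier M" "h (?F i) = ?F' i" if "i \<in> {1..n}" for i
    using mg[OF that] f_closed pow by auto
  have F': "?F' i \<in> carrier M'" if "i \<in> {1..n}" for i
    using F[OF that] hom_in_carrier[OF h(1)] by metis
  have prod: "h (finprod M ?F {1..n}) = finprod M' ?F' {1..n}"
  proof -
    have "h (finprod M ?F {1..n}) = finprod M' (\<lambda>i. h (?F i)) {1..n}"
      by (rule hom_finprod[OF M(1) M' h(1)]) (use F in auto)
    also have "\<dots> = finprod M' ?F' {1..n}"
      by (rule M'.finprod_cong') (use F F' in auto)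
    finally show ?thesis .
  qed
  have c1: "act (gs ! 0) (f (tl gs)) \<in> carrier M" using M(2)[OF g0] f_closed tl_tuples[OF gs] by simp
  have c2: "finprod M ?F {1..n} \<in> carrier M" by (rule M.finprod_closed) (use F in auto)
  have c3: "f (take n gs) [^]\<^bsub>M\<^esub> ((-1::int) ^ (n + 1)) \<in> carrier M"
    using f_closed[OF take_tuples[OF gs]] by simp
  show "coboundary K M act n f gs \<in> carrier M"
    unfolding coboundary_def using c1 c2 c3 by blast
  have "h (coboundary K M act n f gs) = h (act (gs ! 0) (f (tl gs))) \<otimes>\<^bsub>M'\<^esub> h (finprod M ?F {1..n})
      \<otimes>\<^bsub>M'\<^esub> h (f (take n gs) [^]\<^bsub>M\<^esub> ((-1::int) ^ (n + 1)))"
    unfolding coboundary_def using c1 c2 c3 by (simp only: hom_mult[OF h(1)] M.m_closed)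
  also have "\<dots> = coboundary K M' act' n f' gs"
    unfolding coboundary_def prod pow[OF take_tuples[OF gs]]
    using h(2)[OF g0 f_closed[OF tl_tuples[OF gs]]] f(2)[OF tl_tuples[OF gs]] by simp
  finally show "coboundary K M' act' n f' gs = h (coboundary K M act n f gs)" by simp
qed

text \<open>\<open>cd_le\<close> only tests modules whose elements are lists over the group. This loses nothing: a cocycle
  takes values in the submodule generated by its values, and the elements of this submodule can be
  encoded by lists of group elements, namely by concatenating codes \<open>b # g # gs\<close> of the generators
  \<open>g \<cdot> f gs\<close> (if \<open>b = \<one>\<close>) and of their inverses (if \<open>b \<noteq> \<one>\<close>).\<close>

lemma cd_le_imp_cohomology_vanishes:
  fixes K :: "('a, 'c) monoid_scheme" and M :: "('m, 'd) monoid_scheme"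
  assumes K: "group K" and a: "a \<in> carrier K" "a \<noteq> \<one>\<^bsub>K\<^esub>" and cd: "cd_le K n"
    and M: "group_module K M act"
  shows "cohomology_vanishes K M act n"
  unfolding cohomology_vanishes_def
proof (intro allI impI)
  fix f assume f: "cocycle K M act (Suc n) f"
  interpret K: group K by fact
  interpret M: comm_group M using M by (simp add: group_module_def)
  have actc: "\<And>g m. g \<in> carrier K \<Longrightarrow> m \<in> carrier M \<Longrightarrow> act g m \<in> carrier M"
    and act1: "\<And>m. m \<in> carrier M \<Longrightarrow> act \<one>\<^bsub>K\<^esub> m = m"
    and actK: "\<And>g h m. g \<in> carrier K \<Longrightarrow> h \<in> carrier K \<Longrightarrow> m \<in> carrier M \<Longrightarrow>
                 act (g \<otimes>\<^bsub>K\<^esub> h) m = act g (act h m)"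
    and actm: "\<And>g m m'. g \<in> carrier K \<Longrightarrow> m \<in> carrier M \<Longrightarrow> m' \<in> carrier M \<Longrightarrow>
                 act g (m \<otimes>\<^bsub>M\<^esub> m') = act g m \<otimes>\<^bsub>M\<^esub> act g m'"
    using M by (auto simp: group_module_def)
  have act_hom: "group_hom M M (act g)" if "g \<in> carrier K" for g
    using actc actm that by unfold_locales (auto simp: hom_def)
  have fM: "f gs \<in> carrier M" if "gs \<in> tuples K (Suc n)" for gs
    using f that by (simp add: cocycle_def cochain_def)
  \<comment> \<open>All translates are included so that the generated subgroup is stable under the
    action.\<close>
  define W where "W = {act g (f gs) | g gs. g \<in> carrier K \<and> gs \<in> tuples K (Suc n)}"
  have W: "W \<subseteq> carrier M" unfolding W_def using actc fM by auto
  define M0 where "M0 = generate M W"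
  have sub: "subgroup M0 M" unfolding M0_def by (rule M.generate_is_subgroup[OF W])
  interpret M0: subgroup M0 M by fact
  have actM0: "act g m \<in> M0" if g: "g \<in> carrier K" and m: "m \<in> M0" for g m
    using m unfolding M0_def
  proof (induction m rule: generate.induct)
    interpret h: group_hom M M "act g" by (rule act_hom[OF g])
    case one
    then show ?case using generate.one by simp
  next
    case (incl v)
    then obtain g' gs where "v = act g' (f gs)" "g' \<in> carrier K" "gs \<in> tuples K (Suc n)"
      by (auto simp: W_def)
    then have "act g v = act (g \<otimes>\<^bsub>K\<^esub> g') (f gs)" "g \<otimes>\<^bsub>K\<^esub> g' \<in> carrier K"
      using actK g fM by auto
    then have "act g v \<in> W" unfolding W_def using \<open>gs \<in> tuples K (Suc n)\<close> by blast
    then show ?case by (rule generate.incl)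
  next
    interpret h: group_hom M M "act g" by (rule act_hom[OF g])
    case (inv v)
    then obtain g' gs where v: "v = act g' (f gs)" "g' \<in> carrier K" "gs \<in> tuples K (Suc n)"
      by (auto simp: W_def)
    then have "act g v = act (g \<otimes>\<^bsub>K\<^esub> g') (f gs)" "g \<otimes>\<^bsub>K\<^esub> g' \<in> carrier K"
      using actK g fM by auto
    then have "act g v \<in> W" unfolding W_def using v by blast
    moreover have "act g (inv\<^bsub>M\<^esub> v) = inv\<^bsub>M\<^esub> act g v" using inv W by auto
    ultimately show ?case by (simp add: generate.inv)
  next
    case (eng v w)
    then have "v \<in> carrier M" "w \<in> carrier M" using M.generate_in_carrier[OF W] by auto
    then show ?case using eng actm[OF g] by (simp add: generate.eng)
  qed
  \<comment> \<open>A code word is a sign entry, an acting element and the \<open>n + 1\<close>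
    arguments of \<open>f\<close>. The nontrivial element \<open>a\<close> supplies the second value
    of the sign entry.\<close>
  define gen where "gen = (\<lambda>xs. let v = act (xs ! 1) (f (drop 2 xs)) in
     if hd xs = \<one>\<^bsub>K\<^esub> then v else inv\<^bsub>M\<^esub> v)"
  define L where "L = tuples K (Suc (Suc (Suc n)))"
  define F where "F = (\<lambda>yss. foldr (\<lambda>xs v. gen xs \<otimes>\<^bsub>M\<^esub> v) yss \<one>\<^bsub>M\<^esub>)"
  have genM: "gen xs \<in> carrier M" if "xs \<in> L" for xs
  proof -
    have "drop 2 xs \<in> tuples K (Suc n)" "xs ! 1 \<in> carrier K"
      using that by (auto simp: L_def tuples_def dest: in_set_dropD)
    then show ?thesis using actc fM by (auto simp: gen_def Let_def)
  qed
  have Fcl: "F yss \<in> carrier M" if "set yss \<subseteq> L" for yss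
    using that genM by (induction yss) (auto simp: F_def)
  have Fapp: "F (yss @ zss) = F yss \<otimes>\<^bsub>M\<^esub> F zss" if "set yss \<subseteq> L" "set zss \<subseteq> L" for yss zss
    using that(1)
  proof (induction yss)
    case (Cons y yss)
    have "F (y # yss @ zss) = gen y \<otimes>\<^bsub>M\<^esub> F (yss @ zss)" "F (y # yss) = gen y \<otimes>\<^bsub>M\<^esub> F yss"
      by (simp_all add: F_def)
    then show ?case using Cons genM Fcl that(2) by (simp add: M.m_assoc)
  qed (use Fcl[OF that(2)] in \<open>simp add: F_def\<close>)
  have code: "\<exists>yss. set yss \<subseteq> L \<and> F yss = v" if "v \<in> M0" for v
    using that unfolding M0_def
  proof (induction v rule: generate.induct)
    case one
    have "set [] \<subseteq> L \<and> F [] = \<one>\<^bsub>M\<^esub>" by (simp add: F_def)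
    then show ?case by blast
  next
    case (incl v)
    then obtain g gs where v: "v = act g (f gs)" "g \<in> carrier K" "gs \<in> tuples K (Suc n)"
      by (auto simp: W_def)
    then have "set [\<one>\<^bsub>K\<^esub> # g # gs] \<subseteq> L" by (auto simp: L_def tuples_def)
    moreover have "F [\<one>\<^bsub>K\<^esub> # g # gs] = v"
      using v incl W by (auto simp: F_def gen_def)
    ultimately show ?case by blast
  next
    case (inv v)
    then obtain g gs where v: "v = act g (f gs)" "g \<in> carrier K" "gs \<in> tuples K (Suc n)"
      by (auto simp: W_def)
    then have "set [a # g # gs] \<subseteq> L" using a by (auto simp: L_def tuples_def)
    moreover have "F [a # g # gs] = inv\<^bsub>M\<^esub> v"
      using v inv W a by (auto simp: F_def gen_def)
    ultimately show ?case by blast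
  next
    case (eng v w)
    then obtain yss zss where "set yss \<subseteq> L" "F yss = v" "set zss \<subseteq> L" "F zss = w" by blast
    then have "set (yss @ zss) \<subseteq> L \<and> F (yss @ zss) = v \<otimes>\<^bsub>M\<^esub> w" using Fapp by simp
    then show ?case by blast
  qed
  then obtain Y where Y: "\<And>v. v \<in> M0 \<Longrightarrow> set (Y v) \<subseteq> L \<and> F (Y v) = v" by metis
  \<comment> \<open>All code words have length n + 3, so a concatenation can be cut back into words
    in only one way.\<close>
  define enc where "enc = (\<lambda>v. concat (Y v))"
  have inj: "inj_on enc M0"
  proof (rule inj_onI)
    fix v w assume vw: "v \<in> M0" "w \<in> M0" "enc v = enc w"
    have len: "length x = Suc (Suc (Suc n))" if "x \<in> set (Y v) \<union> set (Y w)" for x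
      using that Y vw by (auto simp: L_def tuples_def)
    have "length (concat (Y u)) = length (Y u) * Suc (Suc (Suc n))" if "u \<in> {v, w}" for u
    proof -
      have "map length (Y u) = map (\<lambda>_. Suc (Suc (Suc n))) (Y u)"
        using len that by (intro map_cong) auto
      then show ?thesis by (simp add: length_concat map_replicate_const sum_list_replicate)
    qed
    from this[of v] this[of w] vw(3) have "length (Y v) * Suc (Suc (Suc n)) = length (Y w) * Suc (Suc (Suc n))"
      by (simp add: enc_def)
    then have "length (Y v) = length (Y w)" by (simp only: mult_cancel2) simp
    moreover have "\<forall>(x, y)\<in>set (zip (Y v) (Y w)). length x = length y"
    proof (intro ballI case_prodI2)
      fix p x y assume "p \<in> set (zip (Y v) (Y w))" "p = (x, y)"
      then have "x \<in> set (Y v)" "y \<in> set (Y w)" by (auto dest: set_zip_leftD set_zip_rightD)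
      then show "length x = length y" using len by simp
    qed
    ultimately have "Y v = Y w" using vw(3) concat_eq_concat_iff unfolding enc_def by blast
    then show "v = w" using Y vw by metis
  qed
  define dec where "dec = inv_into M0 enc"
  have de: "dec (enc v) = v" if "v \<in> M0" for v unfolding dec_def using inj that by simp
  \<comment> \<open>The structure of \<open>M0\<close>, transported along \<open>enc\<close>, is a
    module of the type over which \<open>cd_le\<close> quantifies.\<close>
  define M' :: "'a list monoid" where
    "M' = \<lparr>carrier = enc ` M0, monoid.mult = (\<lambda>x y. enc (dec x \<otimes>\<^bsub>M\<^esub> dec y)), one = enc \<one>\<^bsub>M\<^esub>\<rparr>"
  define act' where "act' = (\<lambda>g x. enc (act g (dec x)))"
  have [simp]: "carrier M' = enc ` M0" "\<one>\<^bsub>M'\<^esub> = enc \<one>\<^bsub>M\<^esub>"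
    "\<And>x y. x \<otimes>\<^bsub>M'\<^esub> y = enc (dec x \<otimes>\<^bsub>M\<^esub> dec y)" by (simp_all add: M'_def)
  have M': "comm_group M'"
  proof (rule comm_groupI)
    fix x assume "x \<in> carrier M'"
    then obtain v where v: "v \<in> M0" "x = enc v" by auto
    then have "enc (inv\<^bsub>M\<^esub> v) \<otimes>\<^bsub>M'\<^esub> x = \<one>\<^bsub>M'\<^esub>" "enc (inv\<^bsub>M\<^esub> v) \<in> carrier M'" by (auto simp: de)
    then show "\<exists>y\<in>carrier M'. y \<otimes>\<^bsub>M'\<^esub> x = \<one>\<^bsub>M'\<^esub>" by blast
  qed (auto simp: de M.m_ac)
  have actm0: "act g v \<otimes>\<^bsub>M\<^esub> act g w = act g (v \<otimes>\<^bsub>M\<^esub> w)" if "g \<in> carrier K" "v \<in> M0" "w \<in> M0" for g v w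
    using actm that M0.mem_carrier by simp
  have mod: "group_module K M' act'"
    unfolding group_module_def using M' actM0
    by (auto simp: act'_def de act1 actK actm0)
  have dec_hom: "dec \<in> hom M' M"
    by (rule homI) (auto simp: de)
  have dec_act: "dec (act' g x) = act g (dec x)" if "g \<in> carrier K" "x \<in> carrier M'" for g x
    using that actM0 by (auto simp: act'_def de)
  have fM0: "f gs \<in> M0" if "gs \<in> tuples K (Suc n)" for gs
  proof -
    have "f gs = act \<one>\<^bsub>K\<^esub> (f gs)" using act1 fM that by simp
    then have "f gs \<in> W" unfolding W_def using that by blast
    then show ?thesis unfolding M0_def by (rule generate.incl)
  qed
  define f' where "f' = (\<lambda>gs. enc (f gs))"
  have f'c: "cochain K M' (Suc n) f'" using fM0 by (simp add: cochain_def f'_def)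
  have act'c: "act' g x \<in> carrier M'" if "g \<in> carrier K" "x \<in> carrier M'" for g x
    using that actM0 by (auto simp: act'_def de intro!: imageI)
  have hom_dec: "coboundary K M act k p' gs = dec (coboundary K M' act' k p gs)"
    "coboundary K M' act' k p gs \<in> carrier M'"
    if p: "cochain K M' k p" "\<forall>gs\<in>tuples K k. p' gs = dec (p gs)" and gs: "gs \<in> tuples K (Suc k)"
    for k p p' gs
  proof -
    note * = coboundary_hom[where act = act' and act' = act and h = dec and f = p and f' = p',
        OF K M' _ M.comm_group_axioms dec_hom _ p(1) _ gs]
    show "coboundary K M act k p' gs = dec (coboundary K M' act' k p gs)"
      by (rule *(1)) (erule (1) act'c dec_act | use p(2) in blast)+
    show "coboundary K M' act' k p gs \<in> carrier M'"
      by (rule *(2)) (erule (1) act'c dec_act | use p(2) in blast)+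
  qed
  have "cocycle K M' act' (Suc n) f'"
    unfolding cocycle_def
  proof (intro conjI ballI f'c)
    fix gs assume gs: "gs \<in> tuples K (Suc (Suc n))"
    have f'f: "\<forall>gs\<in>tuples K (Suc n). f gs = dec (f' gs)" using fM0 by (simp add: f'_def de)
    have "dec (coboundary K M' act' (Suc n) f' gs) = coboundary K M act (Suc n) f gs"
      using hom_dec(1)[OF f'c f'f gs] by (rule sym)
    also have "\<dots> = \<one>\<^bsub>M\<^esub>" using f gs by (simp add: cocycle_def)
    finally have "dec (coboundary K M' act' (Suc n) f' gs) = \<one>\<^bsub>M\<^esub>" .
    moreover have "coboundary K M' act' (Suc n) f' gs \<in> enc ` M0"
      using hom_dec(2)[OF f'c f'f gs] by simp
    ultimately show "coboundary K M' act' (Suc n) f' gs = \<one>\<^bsub>M'\<^esub>" by (auto simp: de)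
  qed
  then obtain h' where h': "cochain K M' n h'"
    "\<And>gs. gs \<in> tuples K (Suc n) \<Longrightarrow> f' gs = coboundary K M' act' n h' gs"
    using cd mod unfolding cd_le_def cohomology_vanishes_def by blast
  define h where "h = (\<lambda>gs. dec (h' gs))"
  have "cochain K M n h"
    using h'(1) by (auto simp: cochain_def h_def) (metis M0.mem_carrier de imageE)
  moreover have "f gs = coboundary K M act n h gs" if gs: "gs \<in> tuples K (Suc n)" for gs
  proof -
    have "coboundary K M act n h gs = dec (f' gs)"
      unfolding h'(2)[OF gs]
      by (rule hom_dec(1)[OF h'(1) _ gs]) (simp add: h_def)
    then show ?thesis using fM0[OF gs] by (simp add: f'_def de)
  qed
  ultimately show "\<exists>h. cochain K M n h \<and> (\<forall>gs\<in>tuples K (Suc n). f gs = coboundary K M act n h gs)"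
    by blast
qed

section \<open>Cohomological dimension bounds the rank of abelian subgroups\<close>

text \<open>The points x, x g_1, x g_1 g_2, ... are the vertices of the simplex described by the
  inhomogeneous tuple; each term of the coboundary amounts to deleting one vertex.\<close>

definition prefix_prod :: "('a, 'c) monoid_scheme \<Rightarrow> 'a \<Rightarrow> 'a list \<Rightarrow> nat \<Rightarrow> 'a" where
  "prefix_prod K x gs k = foldl (\<otimes>\<^bsub>K\<^esub>) x (take k gs)"

lemma prefix_prod_0 [simp]: "prefix_prod K x gs 0 = x"
  by (simp add: prefix_prod_def)

lemma prefix_prod_Suc:
  "k < length gs \<Longrightarrow> prefix_prod K x gs (Suc k) = prefix_prod K x gs k \<otimes>\<^bsub>K\<^esub> gs ! k"
  by (simp add: prefix_prod_def take_Suc_conv_app_nth)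

lemma prefix_prod_tl:
  "gs \<noteq> [] \<Longrightarrow> prefix_prod K (x \<otimes>\<^bsub>K\<^esub> gs ! 0) (tl gs) k = prefix_prod K x gs (Suc k)"
  by (cases gs) (simp_all add: prefix_prod_def)

lemma prefix_prod_take: "k \<le> n \<Longrightarrow> prefix_prod K x (take n gs) k = prefix_prod K x gs k"
  by (simp add: prefix_prod_def min_def)

lemma (in group) prefix_prod_closed:
  "x \<in> carrier G \<Longrightarrow> gs \<in> tuples G n \<Longrightarrow> k \<le> n \<Longrightarrow> prefix_prod G x gs k \<in> carrier G"
  by (induction k) (auto simp: prefix_prod_Suc length_tuples nth_tuples)

lemma (in group) prefix_prod_left_mult:
  "y \<in> carrier G \<Longrightarrow> x \<in> carrier G \<Longrightarrow> gs \<in> tuples G n \<Longrightarrow> k \<le> n \<Longrightarrow>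
   prefix_prod G (y \<otimes> x) gs k = y \<otimes> prefix_prod G x gs k"
  by (induction k) (auto simp: prefix_prod_Suc length_tuples nth_tuples m_assoc prefix_prod_closed)

text \<open>Merging the entries \<open>i\<close> and \<open>i + 1\<close>, counted from 1, deletes
  vertex \<open>i\<close>, counted from 0.\<close>

lemma (in group) prefix_prod_merge_at:
  assumes "x \<in> carrier G" "gs \<in> tuples G (Suc n)" "i \<in> {1..n}" "k \<le> n"
  shows "prefix_prod G x (merge_at G i gs) k = prefix_prod G x gs (if k < i then k else Suc k)"
  using assms(4)
proof (induction k)
  case (Suc k)
  have len: "length (merge_at G i gs) = n" "length gs = Suc n"
    using merge_at_tuples[OF assms(2,3)] assms(2) by (auto simp: length_tuples)
  have nth: "merge_at G i gs ! k =
      (if Suc k < i then gs ! k else if Suc k = i then gs ! (i - 1) \<otimes> gs ! i else gs ! Suc k)"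
    by (rule merge_at_nth[OF len(2) assms(3)]) (use Suc.prems in simp)
  have IH: "prefix_prod G x (merge_at G i gs) (Suc k)
      = prefix_prod G x gs (if k < i then k else Suc k) \<otimes> merge_at G i gs ! k"
    using Suc len by (simp add: prefix_prod_Suc)
  have c: "prefix_prod G x gs k \<in> carrier G" "gs ! k \<in> carrier G" "gs ! Suc k \<in> carrier G"
    using prefix_prod_closed[OF assms(1,2), of k] nth_tuples[OF assms(2)] Suc.prems by auto
  consider "Suc k < i" | "Suc k = i" | "i \<le> k" by linarith
  then show ?case
  proof cases
    case 2
    then show ?thesis using IH nth c Suc.prems len by (auto simp: prefix_prod_Suc m_assoc)
  qed (use IH nth Suc.prems len in \<open>auto simp: prefix_prod_Suc\<close>)
qed (use assms in simp)

text \<open>The cup product of the 1-cocycles given by the increments of the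
  \<open>\<chi> i\<close>: factor \<open>i\<close> is the increment of \<open>\<chi> i\<close> along
  edge \<open>i\<close> of the simplex. The value 0 off the carrier is the normalisation of
  \<open>invariant_module\<close>.\<close>

definition cup_cochain :: "('a, 'c) monoid_scheme \<Rightarrow> (nat \<Rightarrow> 'a \<Rightarrow> int) \<Rightarrow> nat \<Rightarrow> 'a list \<Rightarrow> 'a \<Rightarrow> int" where
  "cup_cochain K \<chi> m gs x = (if x \<in> carrier K
     then (\<Prod>i<m. \<chi> i (prefix_prod K x gs (Suc i)) - \<chi> i (prefix_prod K x gs i)) else 0)"

section \<open>The cocycle identity for the cup product\<close>

lemma alternating_sum_telescope:
  fixes T :: "nat \<Rightarrow> int"
  shows "T 0 + (\<Sum>i=1..m. (-1) ^ i * (T (i - 1) + T i)) + (-1) ^ (m + 1) * T m = 0"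
  by (induction m) (auto simp: algebra_simps)

text \<open>\<open>T i\<close> runs over all edges except edge \<open>i\<close>. Deleting vertex
  \<open>i\<close> fuses the edges \<open>i - 1\<close> and \<open>i\<close>, and the increment of
  \<open>\<chi> (i - 1)\<close> along the fused edge is the sum of its increments along the two.
  \<open>R\<close> collects the common factors.\<close>

lemma delete_point_prod:
  fixes \<chi> :: "nat \<Rightarrow> 'a \<Rightarrow> int" and p :: "nat \<Rightarrow> 'a" and m :: nat
  defines "T \<equiv> \<lambda>i. \<Prod>k<m. (if k < i then \<chi> k (p (Suc k)) - \<chi> k (p k)
                                   else \<chi> k (p (Suc (Suc k))) - \<chi> k (p (Suc k)))"
  assumes "i \<in> {1..m}"
  shows "(\<Prod>k<m. \<chi> k (p (if Suc k < i then Suc k else Suc (Suc k))) - \<chi> k (p (if k < i then k else Suc k)))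
    = T (i - 1) + T i"
proof -
  let ?g = "\<lambda>k. if Suc k < i then \<chi> k (p (Suc k)) - \<chi> k (p k)
                 else \<chi> k (p (Suc (Suc k))) - \<chi> k (p (Suc k))"
  define R where "R = (\<Prod>k\<in>{..<m} - {i - 1}. ?g k)"
  have split: "(\<Prod>k<m. F k) = F (i - 1) * R" if "\<And>k. k \<noteq> i - 1 \<Longrightarrow> F k = ?g k" for F :: "nat \<Rightarrow> int"
  proof -
    have "(\<Prod>k<m. F k) = F (i - 1) * (\<Prod>k\<in>{..<m} - {i - 1}. F k)"
      using assms(2) by (intro prod.remove) auto
    also have "(\<Prod>k\<in>{..<m} - {i - 1}. F k) = R"
      unfolding R_def by (rule prod.cong) (use that in auto)
    finally show ?thesis .
  qed
  have i: "i - 1 < i" "Suc (i - 1) = i" using assms(2) by auto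
  have "T (i - 1) = (\<chi> (i - 1) (p (Suc i)) - \<chi> (i - 1) (p i)) * R"
    unfolding T_def using i by (subst split) auto
  moreover have "T i = (\<chi> (i - 1) (p i) - \<chi> (i - 1) (p (i - 1))) * R"
    unfolding T_def using i by (subst split) auto
  moreover have "(\<Prod>k<m. \<chi> k (p (if Suc k < i then Suc k else Suc (Suc k))) - \<chi> k (p (if k < i then k else Suc k)))
     = (\<chi> (i - 1) (p (Suc i)) - \<chi> (i - 1) (p (i - 1))) * R"
    using i by (subst split) auto
  ultimately show ?thesis by (simp add: algebra_simps)
qed

text \<open>The first face is \<open>T 0\<close>, the last is \<open>T m\<close>, and the inner face
  \<open>i\<close> is \<open>T (i - 1) + T i\<close>; with alternating signs they telescope.\<close>

lemma (in group) cup_cochain_cocycle_identity: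
  assumes x: "x \<in> carrier G" and gs: "gs \<in> tuples G (Suc m)"
  shows "cup_cochain G \<chi> m (tl gs) (x \<otimes> gs ! 0)
    + (\<Sum>i=1..m. (-1) ^ i * cup_cochain G \<chi> m (merge_at G i gs) x)
    + (-1) ^ (m + 1) * cup_cochain G \<chi> m (take m gs) x = 0"
proof -
  define p where "p = prefix_prod G x gs"
  define T where "T = (\<lambda>i. \<Prod>k<m. (if k < i then \<chi> k (p (Suc k)) - \<chi> k (p k)
                                   else \<chi> k (p (Suc (Suc k))) - \<chi> k (p (Suc k))))"
  have ne: "gs \<noteq> []" using gs by (auto simp: tuples_def)
  have "x \<otimes> gs ! 0 \<in> carrier G" using x nth_tuples[OF gs] by simp
  then have 1: "cup_cochain G \<chi> m (tl gs) (x \<otimes> gs ! 0) = T 0"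
    using ne by (simp add: cup_cochain_def T_def p_def prefix_prod_tl)
  have 2: "cup_cochain G \<chi> m (take m gs) x = T m"
    using x by (auto simp: cup_cochain_def T_def p_def prefix_prod_take intro!: prod.cong)
  have 3: "cup_cochain G \<chi> m (merge_at G i gs) x = T (i - 1) + T i" if i: "i \<in> {1..m}" for i
  proof -
    have "cup_cochain G \<chi> m (merge_at G i gs) x = (\<Prod>k<m. \<chi> k (p (if Suc k < i then Suc k else Suc (Suc k)))
        - \<chi> k (p (if k < i then k else Suc k)))"
      using x by (auto simp: cup_cochain_def p_def prefix_prod_merge_at[OF x gs i] intro!: prod.cong)
    also have "\<dots> = T (i - 1) + T i" unfolding T_def by (rule delete_point_prod[OF i])
    finally show ?thesis .
  qed
  have "(\<Sum>i=1..m. (-1) ^ i * cup_cochain G \<chi> m (merge_at G i gs) x)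
      = (\<Sum>i=1..m. (-1) ^ i * (T (i - 1) + T i))"
    using 3 by (intro sum.cong) auto
  then show ?thesis using alternating_sum_telescope[of T m] 1 2 by simp
qed

text \<open>For \<open>E\<close> inside the group and with the action \<open>translation\<close>,
  this is the module coinduced from the trivial module of integers over the subgroup generated by
  \<open>E\<close>; by Shapiro's lemma it sees the cohomology of that subgroup. Vanishing off the
  carrier makes functions equal once they agree on it.\<close>

definition invariant_module :: "('a, 'c) monoid_scheme \<Rightarrow> 'a set \<Rightarrow> ('a \<Rightarrow> int) monoid" where
  "invariant_module K E = \<lparr>carrier = {\<phi>. (\<forall>x. x \<notin> carrier K \<longrightarrow> \<phi> x = 0) \<and>
       (\<forall>y\<in>E. \<forall>x\<in>carrier K. \<phi> (y \<otimes>\<^bsub>K\<^esub> x) = \<phi> x)},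
     monoid.mult = (\<lambda>\<phi> \<psi> x. \<phi> x + \<psi> x), one = (\<lambda>_. 0)\<rparr>"

definition translation :: "('a, 'c) monoid_scheme \<Rightarrow> 'a \<Rightarrow> ('a \<Rightarrow> int) \<Rightarrow> 'a \<Rightarrow> int" where
  "translation K g \<phi> = (\<lambda>x. if x \<in> carrier K then \<phi> (x \<otimes>\<^bsub>K\<^esub> g) else 0)"

lemma comm_group_invariant_module: "comm_group (invariant_module K E)"
proof (rule comm_groupI)
  fix \<phi> assume "\<phi> \<in> carrier (invariant_module K E)"
  then show "\<exists>\<psi>\<in>carrier (invariant_module K E).
      \<psi> \<otimes>\<^bsub>invariant_module K E\<^esub> \<phi> = \<one>\<^bsub>invariant_module K E\<^esub>"
    by (intro bexI[of _ "\<lambda>x. - \<phi> x"]) (auto simp: invariant_module_def)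
qed (auto simp: invariant_module_def algebra_simps)

lemma (in group) group_module_invariant:
  assumes "E \<subseteq> carrier G"
  shows "group_module G (invariant_module G E) (translation G)"
  unfolding group_module_def
  using comm_group_invariant_module[of G E] assms
  by (auto simp: invariant_module_def translation_def m_assoc fun_eq_iff subset_iff)

section \<open>Pointwise evaluation of coboundaries\<close>

lemma finprod_integer_group: "finprod integer_group F I = sum F I"
proof -
  interpret comm_group integer_group by (rule abelian_integer_group)
  show ?thesis
    by (cases "finite I", induction I rule: finite_induct) auto
qed

lemma eval_hom: "(\<lambda>\<phi>. \<phi> x) \<in> hom (invariant_module K E) integer_group"
  by (rule homI) (auto simp: invariant_module_def)

text \<open>Evaluation at \<open>x\<close> is a homomorphism to the integers, so it turns powers and
  \<open>finprod\<close> into multiples and sums.\<close>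

lemma coboundary_invariant_module:
  assumes K: "group K" and E: "E \<subseteq> carrier K" and h: "cochain K (invariant_module K E) n h"
    and gs: "gs \<in> tuples K (Suc n)" and x: "x \<in> carrier K"
  shows "coboundary K (invariant_module K E) (translation K) n h gs x =
    h (tl gs) (x \<otimes>\<^bsub>K\<^esub> gs ! 0) + (\<Sum>i=1..n. (-1) ^ i * h (merge_at K i gs) x)
    + (-1) ^ (n + 1) * h (take n gs) x"
proof -
  let ?M = "invariant_module K E"
  interpret M: comm_group ?M by (rule comm_group_invariant_module)
  note int = abelian_integer_group
  have hc: "h t \<in> carrier ?M" if "t \<in> tuples K n" for t using h that by (simp add: cochain_def)
  have pow: "(h t [^]\<^bsub>?M\<^esub> k) x = k * h t x" if "t \<in> tuples K n" for t and k :: int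
    using hom_int_pow[OF eval_hom hc[OF that] M.is_group group_integer_group, of k x] by simp
  note mg = group.merge_at_tuples[OF K gs]
  have "(finprod ?M (\<lambda>i. h (merge_at K i gs) [^]\<^bsub>?M\<^esub> ((-1::int) ^ i)) {1..n}) x
      = (\<Sum>i=1..n. (h (merge_at K i gs) [^]\<^bsub>?M\<^esub> ((-1::int) ^ i)) x)"
    using hom_finprod[OF M.comm_group_axioms int eval_hom, of "{1..n}"] mg hc
    by (simp add: finprod_integer_group)
  also have "\<dots> = (\<Sum>i=1..n. (-1) ^ i * h (merge_at K i gs) x)"
    using mg pow by (intro sum.cong) auto
  finally have "(finprod ?M (\<lambda>i. h (merge_at K i gs) [^]\<^bsub>?M\<^esub> ((-1::int) ^ i)) {1..n}) x
      = (\<Sum>i=1..n. (-1) ^ i * h (merge_at K i gs) x)" .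
  moreover have "(\<phi> \<otimes>\<^bsub>?M\<^esub> \<psi>) x = \<phi> x + \<psi> x" for \<phi> \<psi> by (simp add: invariant_module_def)
  ultimately show ?thesis
    unfolding coboundary_def using pow[OF take_tuples[OF gs]] x by (simp add: translation_def)
qed

text \<open>Each \<open>x\<close> is a lattice element times a chosen representative of its coset,
  and \<open>\<chi> i x\<close> is coordinate \<open>i\<close> of the lattice element. Left
  multiplication by \<open>e j\<close> keeps the representative and shifts coordinate
  \<open>j\<close> by 1.\<close>

lemma coset_coordinates:
  assumes K: "group K" and A: "subgroup A K" and comm: "comm_group (K\<lparr>carrier := A\<rparr>)"
    and e: "int_independent (K\<lparr>carrier := A\<rparr>) e r"
  obtains \<chi> :: "nat \<Rightarrow> 'a \<Rightarrow> int" where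
    "\<And>x i j. x \<in> carrier K \<Longrightarrow> i < r \<Longrightarrow> j < r \<Longrightarrow> \<chi> i (e j \<otimes>\<^bsub>K\<^esub> x) = \<chi> i x + (if i = j then 1 else 0)"
proof -
  interpret K: group K by fact
  interpret A: comm_group "K\<lparr>carrier := A\<rparr>" by fact
  interpret sA: subgroup A K by fact
  define c where "c = (\<lambda>v. int_comb (K\<lparr>carrier := A\<rparr>) e v r)"
  note car = A.int_independent_carrier[OF e]
  have cK: "c v \<in> carrier K" for v using A.int_comb_closed[OF car] by (simp add: c_def)
  have cadd: "c (\<lambda>i. v i + w i) = c v \<otimes>\<^bsub>K\<^esub> c w" for v w
    using A.int_comb_add[OF car] by (simp add: c_def)
  define u where "u = (\<lambda>j i::nat. if i = j then 1 else 0 :: int)"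
  have cu: "c (u j) = e j" if "j < r" for j
    using A.int_comb_unit[OF car that] by (simp add: c_def u_def)
  have c0: "c (\<lambda>_. 0) = \<one>\<^bsub>K\<^esub>" using A.int_comb_zero[OF car] by (simp add: c_def)
  \<comment> \<open>\<open>C y\<close> is the right coset of \<open>y\<close> under the span of
    \<open>e\<close>. The representative \<open>t y\<close> is chosen from this set alone, so it is
    constant along a coset.\<close>
  define C where "C = (\<lambda>y. {z \<in> carrier K. \<exists>v. y = c v \<otimes>\<^bsub>K\<^esub> z})"
  define t where "t = (\<lambda>y. SOME z. z \<in> C y)"
  define V where "V = (\<lambda>y. SOME v. y = c v \<otimes>\<^bsub>K\<^esub> t y)"
  have t: "t y \<in> C y" if "y \<in> carrier K" for y
  proof -
    have "y \<in> C y" using that c0 by (auto simp: C_def intro!: exI[of _ "\<lambda>_. 0"])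
    then show ?thesis unfolding t_def by (rule someI)
  qed
  have V: "y = c (V y) \<otimes>\<^bsub>K\<^esub> t y" if "y \<in> carrier K" for y
  proof -
    have "\<exists>v. y = c v \<otimes>\<^bsub>K\<^esub> t y" using t[OF that] unfolding C_def by blast
    then show ?thesis unfolding V_def by (rule someI_ex)
  qed
  have Ce: "C (e j \<otimes>\<^bsub>K\<^esub> y) = C y" if j: "j < r" and y: "y \<in> carrier K" for j y
  proof (intro equalityI subsetI)
    fix z assume "z \<in> C y"
    then obtain v where z: "z \<in> carrier K" "y = c v \<otimes>\<^bsub>K\<^esub> z" by (auto simp: C_def)
    then have "e j \<otimes>\<^bsub>K\<^esub> y = c (\<lambda>i. u j i + v i) \<otimes>\<^bsub>K\<^esub> z"
      using cK by (simp add: cadd K.m_assoc flip: cu[OF j])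
    then show "z \<in> C (e j \<otimes>\<^bsub>K\<^esub> y)" using z unfolding C_def by blast
  next
    fix z assume "z \<in> C (e j \<otimes>\<^bsub>K\<^esub> y)"
    then obtain v where z: "z \<in> carrier K" "e j \<otimes>\<^bsub>K\<^esub> y = c v \<otimes>\<^bsub>K\<^esub> z" by (auto simp: C_def)
    have "c (\<lambda>i. - u j i) \<otimes>\<^bsub>K\<^esub> c (u j) = \<one>\<^bsub>K\<^esub>"
      using cadd[of "\<lambda>i. - u j i" "u j"] c0 by simp
    then have "y = c (\<lambda>i. - u j i) \<otimes>\<^bsub>K\<^esub> (e j \<otimes>\<^bsub>K\<^esub> y)"
      using cK y by (simp flip: cu[OF j] K.m_assoc)
    also have "\<dots> = c (\<lambda>i. - u j i + v i) \<otimes>\<^bsub>K\<^esub> z"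
      unfolding z(2) cadd using cK z(1) by (simp add: K.m_assoc)
    finally show "z \<in> C y" using z unfolding C_def by blast
  qed
  show ?thesis
  proof (rule that[of "\<lambda>i y. V y i"])
    fix x i j assume x: "x \<in> carrier K" and i: "i < r" and j: "j < r"
    have ejK: "e j \<in> carrier K" using cK[of "u j"] cu[OF j] by simp
    let ?y = "e j \<otimes>\<^bsub>K\<^esub> x"
    have ty: "t ?y = t x" unfolding t_def Ce[OF j x] ..
    have tK: "t x \<in> carrier K" using t[OF x] by (simp add: C_def)
    have "c (V ?y) \<otimes>\<^bsub>K\<^esub> t x = ?y" using V[of ?y] ejK x ty by simp
    also have "\<dots> = e j \<otimes>\<^bsub>K\<^esub> (c (V x) \<otimes>\<^bsub>K\<^esub> t x)" using V[OF x] by simp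
    also have "\<dots> = c (\<lambda>i. u j i + V x i) \<otimes>\<^bsub>K\<^esub> t x"
      unfolding cadd cu[OF j] using ejK cK tK by (simp add: K.m_assoc)
    finally have "c (V ?y) = c (\<lambda>i. u j i + V x i)"
      using cK tK by simp
    then have "V ?y i = u j i + V x i"
      using A.int_independent_inject[OF e _ i] by (simp add: c_def)
    then show "V ?y i = V x i + (if i = j then 1 else 0)" by (simp add: u_def)
  qed
qed

text \<open>The cycle (0 1 ... n), built from \<open>n\<close> adjacent transpositions so that its
  sign comes out by induction.\<close>

primrec rotation :: "nat \<Rightarrow> nat \<Rightarrow> nat" where
  "rotation 0 = id"
| "rotation (Suc n) = rotation n \<circ> transpose n (Suc n)"

lemma rotation_eq: "rotation n k = (if k < n then Suc k else if k = n then 0 else k)"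
  by (induction n arbitrary: k) (auto simp: transpose_def)

lemma rotation_permutes: "rotation n permutes {..<Suc n}"
proof (induction n)
  case (Suc n)
  have "rotation n permutes {..<Suc (Suc n)}"
    by (rule permutes_subset[OF Suc]) auto
  moreover have "transpose n (Suc n) permutes {..<Suc (Suc n)}"
    by (rule permutes_swap_id) auto
  ultimately show ?case
    using permutes_compose by (simp only: rotation.simps)
qed (simp only: rotation.simps permutes_id)

lemma sign_rotation: "sign (rotation n) = (-1) ^ n"
proof (induction n)
  case (Suc n)
  have "permutation (rotation n)"
    using rotation_permutes[of n] permutation_permutes by blast
  from sign_compose[OF this permutation_swap_id, of n "Suc n"] Suc
  show ?case by (simp add: sign_swap_id del: o_apply flip: comp_def)
qed simp

text \<open>The antisymmetrised value of a coboundary with trivial action on a commuting family vanishes: the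
  terms with a product cancel in pairs, and the first and last terms differ by a rotation.\<close>

lemma antisymmetrised_coboundary:
  fixes H :: "'a list \<Rightarrow> int"
  assumes comm: "\<And>i j. i \<le> n \<Longrightarrow> j \<le> n \<Longrightarrow> e i \<otimes>\<^bsub>K\<^esub> e j = e j \<otimes>\<^bsub>K\<^esub> e i"
  defines "gs \<equiv> \<lambda>\<sigma>. map (\<lambda>k. e (\<sigma> k)) [0..<Suc n]"
  shows "(\<Sum>\<sigma>\<in>{\<sigma>. \<sigma> permutes {..<Suc n}}. sign \<sigma> *
     (H (tl (gs \<sigma>)) + (\<Sum>i=1..n. (-1) ^ i * H (merge_at K i (gs \<sigma>))) + (-1) ^ (n + 1) * H (take n (gs \<sigma>)))) = 0"
proof -
  let ?P = "{\<sigma>. \<sigma> permutes {..<Suc n}}"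
  have perm: "permutation \<sigma>" if "\<sigma> \<in> ?P" for \<sigma> using that permutation_permutes by blast
  have len: "length (gs \<sigma>) = Suc n" for \<sigma> by (simp add: gs_def del: upt_Suc)
  have nth: "gs \<sigma> ! k = e (\<sigma> k)" if "k < Suc n" for \<sigma> k
    using that by (simp add: gs_def del: upt_Suc)
  have merge: "(\<Sum>\<sigma>\<in>?P. sign \<sigma> * H (merge_at K i (gs \<sigma>))) = 0" if i: "i \<in> {1..n}" for i
  proof -
    let ?t = "transpose (i - 1) i"
    have t: "?t permutes {..<Suc n}" using i by (intro permutes_swap_id) auto
    \<comment> \<open>Swapping the two merged entries leaves their product unchanged, since they
      commute, but flips the sign of the permutation. So the sum is its own negative.\<close>
    have eq: "merge_at K i (gs (\<sigma> \<circ> ?t)) = merge_at K i (gs \<sigma>)" if \<sigma>: "\<sigma> \<in> ?P" for \<sigma>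
    proof (rule nth_equalityI)
      have lm: "length (merge_at K i (gs \<tau>)) = n" for \<tau>
        using i len[of \<tau>] by (auto simp: merge_at_def)
      show "length (merge_at K i (gs (\<sigma> \<circ> ?t))) = length (merge_at K i (gs \<sigma>))" using lm by simp
      fix j assume "j < length (merge_at K i (gs (\<sigma> \<circ> ?t)))"
      then have j: "j < n" using lm by simp
      have "\<sigma> k \<le> n" if "k \<le> n" for k
        using permutes_in_image[of \<sigma> "{..<Suc n}" k] \<sigma> that by auto
      then have "e (\<sigma> (i - 1)) \<otimes>\<^bsub>K\<^esub> e (\<sigma> i) = e (\<sigma> i) \<otimes>\<^bsub>K\<^esub> e (\<sigma> (i - 1))"
        using comm i by auto
      then show "merge_at K i (gs (\<sigma> \<circ> ?t)) ! j = merge_at K i (gs \<sigma>) ! j"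
        using i j by (auto simp: merge_at_nth[OF len i j] nth transpose_def)
    qed
    have "(\<Sum>\<sigma>\<in>?P. sign \<sigma> * H (merge_at K i (gs \<sigma>)))
        = (\<Sum>\<sigma>\<in>?P. sign (\<sigma> \<circ> ?t) * H (merge_at K i (gs (\<sigma> \<circ> ?t))))"
      by (rule sum_permutations_compose_right[OF t])
    also have "\<dots> = (\<Sum>\<sigma>\<in>?P. - (sign \<sigma> * H (merge_at K i (gs \<sigma>))))"
    proof (rule sum.cong)
      fix \<sigma> assume \<sigma>: "\<sigma> \<in> ?P"
      have "sign (\<sigma> \<circ> ?t) = - sign \<sigma>"
        using sign_compose[OF perm[OF \<sigma>] permutation_swap_id, of "i - 1" i] i
        by (auto simp: sign_swap_id)
      then show "sign (\<sigma> \<circ> ?t) * H (merge_at K i (gs (\<sigma> \<circ> ?t))) = - (sign \<sigma> * H (merge_at K i (gs \<sigma>)))"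
        using eq[OF \<sigma>] by simp
    qed simp
    finally show ?thesis by (simp add: sum_negf)
  qed
  have "(\<Sum>\<sigma>\<in>?P. sign \<sigma> * H (take n (gs \<sigma>)))
      = (\<Sum>\<sigma>\<in>?P. sign (\<sigma> \<circ> rotation n) * H (take n (gs (\<sigma> \<circ> rotation n))))"
    by (rule sum_permutations_compose_right[OF rotation_permutes])
  also have "\<dots> = (\<Sum>\<sigma>\<in>?P. (-1) ^ n * (sign \<sigma> * H (tl (gs \<sigma>))))"
  proof (rule sum.cong)
    fix \<sigma> assume \<sigma>: "\<sigma> \<in> ?P"
    \<comment> \<open>Rotation moves the first entry to the end, where \<open>take n\<close> drops
      it.\<close>
    have "take n (gs (\<sigma> \<circ> rotation n)) = tl (gs \<sigma>)"
      by (rule nth_equalityI) (auto simp: len nth nth_tl rotation_eq)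
    moreover have "sign (\<sigma> \<circ> rotation n) = sign \<sigma> * (-1) ^ n"
      using sign_compose[OF perm[OF \<sigma>] perm[of "rotation n"]] rotation_permutes sign_rotation by simp
    ultimately show "sign (\<sigma> \<circ> rotation n) * H (take n (gs (\<sigma> \<circ> rotation n)))
        = (-1) ^ n * (sign \<sigma> * H (tl (gs \<sigma>)))" by simp
  qed simp
  finally have rot: "(\<Sum>\<sigma>\<in>?P. sign \<sigma> * H (take n (gs \<sigma>))) = (-1) ^ n * (\<Sum>\<sigma>\<in>?P. sign \<sigma> * H (tl (gs \<sigma>)))"
    by (simp add: sum_distrib_left)
  have "(\<Sum>\<sigma>\<in>?P. sign \<sigma> *
     (H (tl (gs \<sigma>)) + (\<Sum>i=1..n. (-1) ^ i * H (merge_at K i (gs \<sigma>))) + (-1) ^ (n + 1) * H (take n (gs \<sigma>))))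
     = (\<Sum>\<sigma>\<in>?P. sign \<sigma> * H (tl (gs \<sigma>)))
     + (\<Sum>\<sigma>\<in>?P. \<Sum>i=1..n. (-1) ^ i * (sign \<sigma> * H (merge_at K i (gs \<sigma>))))
     + (-1) ^ (n + 1) * (\<Sum>\<sigma>\<in>?P. sign \<sigma> * H (take n (gs \<sigma>)))"
    unfolding sum_distrib_left sum.distrib[symmetric]
    by (rule sum.cong) (simp_all add: distrib_left right_diff_distrib sum_distrib_left mult.left_commute)
  also have "(\<Sum>\<sigma>\<in>?P. \<Sum>i=1..n. (-1) ^ i * (sign \<sigma> * H (merge_at K i (gs \<sigma>))))
     = (\<Sum>i=1..n. (-1) ^ i * (\<Sum>\<sigma>\<in>?P. sign \<sigma> * H (merge_at K i (gs \<sigma>))))"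
    by (subst sum.swap) (simp add: sum_distrib_left)
  also have "\<dots> = 0" using merge by simp
  finally show ?thesis unfolding rot by (simp add: mult.assoc[symmetric] power_add[symmetric])
qed

text \<open>On tuples from the family, evaluation at the identity turns the coinduced coefficients
  into integers with trivial action; this brings the coboundary into the form of
  \<open>antisymmetrised_coboundary\<close>.\<close>

theorem rank_le_of_cd_le:
  assumes K: "group K" and cd: "cd_le K n"
    and A: "subgroup A K" and comm: "comm_group (K\<lparr>carrier := A\<rparr>)"
  shows "rank_le (K\<lparr>carrier := A\<rparr>) n"
  unfolding rank_le_def
proof (intro allI notI)
  fix e assume e: "int_independent (K\<lparr>carrier := A\<rparr>) e (Suc n)"
  interpret K: group K by fact
  interpret A: comm_group "K\<lparr>carrier := A\<rparr>" by fact
  interpret sA: subgroup A K by fact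
  have eA: "e i \<in> A" if "i < Suc n" for i using A.int_independent_carrier[OF e] that by simp
  have eK: "e i \<in> carrier K" if "i < Suc n" for i using eA[OF that] sA.mem_carrier by simp
  have Acomm: "x \<otimes>\<^bsub>K\<^esub> y = y \<otimes>\<^bsub>K\<^esub> x" if "x \<in> A" "y \<in> A" for x y using A.m_comm that by simp
  \<comment> \<open>This nontrivial element serves as the second sign symbol in
    \<open>cd_le_imp_cohomology_vanishes\<close>.\<close>
  have "e 0 \<noteq> \<one>\<^bsub>K\<^esub>"
  proof
    assume "e 0 = \<one>\<^bsub>K\<^esub>"
    then have "int_comb (K\<lparr>carrier := A\<rparr>) e (\<lambda>i. if i = 0 then 1 else 0) (Suc n) = \<one>\<^bsub>K\<lparr>carrier := A\<rparr>\<^esub>"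
      using A.int_comb_unit[OF A.int_independent_carrier[OF e], of 0] by (simp del: int_comb.simps)
    from A.int_independentD[OF e this, of 0] show False by simp
  qed
  obtain \<chi> :: "nat \<Rightarrow> 'a \<Rightarrow> int" where \<chi>: "\<And>x i j. x \<in> carrier K \<Longrightarrow> i < Suc n \<Longrightarrow> j < Suc n \<Longrightarrow>
      \<chi> i (e j \<otimes>\<^bsub>K\<^esub> x) = \<chi> i x + (if i = j then 1 else 0)"
    using coset_coordinates[OF K A comm e] by blast
  define E where "E = e ` {..<Suc n}"
  have E: "E \<subseteq> carrier K" using eK by (auto simp: E_def)
  let ?M = "invariant_module K E"
  define f where "f = cup_cochain K \<chi> (Suc n)"
  have fc: "cochain K ?M (Suc n) f"
    unfolding cochain_def
  proof
    fix gs assume gs: "gs \<in> tuples K (Suc n)"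
    \<comment> \<open>Left multiplication by \<open>e j\<close> shifts \<open>\<chi> i\<close> by a
      constant, which cancels in every increment.\<close>
    have "f gs (e j \<otimes>\<^bsub>K\<^esub> x) = f gs x" if j: "j < Suc n" and x: "x \<in> carrier K" for j x
    proof -
      have "\<chi> i (prefix_prod K (e j \<otimes>\<^bsub>K\<^esub> x) gs k) = \<chi> i (prefix_prod K x gs k) + (if i = j then 1 else 0)"
        if "i < Suc n" "k \<le> Suc n" for i k
        using K.prefix_prod_left_mult[OF eK[OF j] x gs that(2)] \<chi>[OF K.prefix_prod_closed[OF x gs that(2)] that(1) j]
        by simp
      then show ?thesis
        using x eK[OF j] by (auto simp: f_def cup_cochain_def intro!: prod.cong)
    qed
    then show "f gs \<in> carrier ?M"
      by (auto simp: invariant_module_def E_def) (simp add: f_def cup_cochain_def)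
  qed
  interpret M: comm_group ?M by (rule comm_group_invariant_module)
  have mod: "group_module K ?M (translation K)" by (rule K.group_module_invariant[OF E])
  have act: "translation K g \<phi> \<in> carrier ?M" if "g \<in> carrier K" "\<phi> \<in> carrier ?M" for g \<phi>
    using mod that by (simp add: group_module_def)
  have "cocycle K ?M (translation K) (Suc n) f"
    unfolding cocycle_def
  proof (intro conjI ballI fc)
    fix gs assume gs: "gs \<in> tuples K (Suc (Suc n))"
    let ?c = "coboundary K ?M (translation K) (Suc n) f gs"
    have "?c \<in> carrier ?M"
      by (rule coboundary_hom(2)[where M' = ?M and h = id and f = f and f' = f, OF K M.comm_group_axioms _ M.comm_group_axioms])
        (use act fc gs in \<open>auto simp: hom_def\<close>)
    then have "?c x = 0" if "x \<notin> carrier K" for x using that by (simp add: invariant_module_def)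
    moreover have "?c x = 0" if x: "x \<in> carrier K" for x
      using coboundary_invariant_module[OF K E fc gs x] K.cup_cochain_cocycle_identity[OF x gs, of \<chi>]
      by (simp only: f_def)
    ultimately show "?c = \<one>\<^bsub>?M\<^esub>" by (auto simp: invariant_module_def)
  qed
  moreover have "cohomology_vanishes K ?M (translation K) n"
    by (rule cd_le_imp_cohomology_vanishes[OF K eK \<open>e 0 \<noteq> \<one>\<^bsub>K\<^esub>\<close> cd mod]) simp
  ultimately obtain h where h: "cochain K ?M n h"
    "\<And>gs. gs \<in> tuples K (Suc n) \<Longrightarrow> f gs = coboundary K ?M (translation K) n h gs"
    unfolding cohomology_vanishes_def by blast
  let ?P = "{\<sigma>. \<sigma> permutes {..<Suc n}}"
  define gs where "gs = (\<lambda>\<sigma>. map (\<lambda>k. e (\<sigma> k)) [0..<Suc n])"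
  have lenth: "length (gs \<sigma>) = Suc n" "k < Suc n \<Longrightarrow> gs \<sigma> ! k = e (\<sigma> k)" for \<sigma> k
    by (simp_all add: gs_def del: upt_Suc)
  have \<sigma>lt: "\<sigma> k < Suc n" if "\<sigma> \<in> ?P" "k < Suc n" for \<sigma> k
    using permutes_in_image[of \<sigma> "{..<Suc n}" k] that by auto
  have gsK: "gs \<sigma> \<in> tuples K (Suc n)" if "\<sigma> \<in> ?P" for \<sigma>
    unfolding tuples_def using lenth(1) eK \<sigma>lt[OF that] by (auto simp: gs_def simp del: upt_Suc)
  define H where "H = (\<lambda>t. h t \<one>\<^bsub>K\<^esub>)"
  have cob: "f (gs \<sigma>) \<one>\<^bsub>K\<^esub> = H (tl (gs \<sigma>)) + (\<Sum>i=1..n. (-1) ^ i * H (merge_at K i (gs \<sigma>)))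
      + (-1) ^ (n + 1) * H (take n (gs \<sigma>))" if \<sigma>: "\<sigma> \<in> ?P" for \<sigma>
  proof -
    note g = gsK[OF \<sigma>]
    have "h (tl (gs \<sigma>)) \<in> carrier ?M" using h(1) tl_tuples[OF g] by (simp add: cochain_def)
    moreover have "gs \<sigma> ! 0 \<in> E" using lenth(2)[of 0] \<sigma>lt[OF \<sigma>, of 0] by (simp add: E_def)
    \<comment> \<open>Invariance concerns left multiplication by \<open>E\<close>, so the identity
      has to stand on the right.\<close>
    moreover have "\<one>\<^bsub>K\<^esub> \<otimes>\<^bsub>K\<^esub> gs \<sigma> ! 0 = gs \<sigma> ! 0 \<otimes>\<^bsub>K\<^esub> \<one>\<^bsub>K\<^esub>"
      using nth_tuples[OF g, of 0] by simp
    ultimately have "h (tl (gs \<sigma>)) (\<one>\<^bsub>K\<^esub> \<otimes>\<^bsub>K\<^esub> gs \<sigma> ! 0) = H (tl (gs \<sigma>))"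
      by (simp add: invariant_module_def H_def del: K.l_one K.r_one)
    then show ?thesis
      unfolding h(2)[OF g] coboundary_invariant_module[OF K E h(1) g K.one_closed] by (simp add: H_def)
  qed
  have val: "f (gs \<sigma>) \<one>\<^bsub>K\<^esub> = (if \<sigma> = id then 1 else 0)" if \<sigma>: "\<sigma> \<in> ?P" for \<sigma>
  proof -
    have pA: "prefix_prod K \<one>\<^bsub>K\<^esub> (gs \<sigma>) k \<in> A" if "k \<le> Suc n" for k
      using that
    proof (induction k)
      case (Suc k)
      then show ?case using lenth eA \<sigma>lt[OF \<sigma>] by (simp add: prefix_prod_Suc)
    qed simp
    have "\<chi> i (prefix_prod K \<one>\<^bsub>K\<^esub> (gs \<sigma>) (Suc i)) - \<chi> i (prefix_prod K \<one>\<^bsub>K\<^esub> (gs \<sigma>) i) = (if i = \<sigma> i then 1 else 0)"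
      if i: "i < Suc n" for i
    proof -
      \<comment> \<open>Prefix products grow on the right, while \<open>\<chi>\<close> is controlled
        under left multiplication; commutativity of \<open>A\<close> moves the new factor to the
        front. Step \<open>i\<close> then changes \<open>\<chi> i\<close> only if
        \<open>\<sigma> i = i\<close>, so a single moved point makes the product vanish.\<close>
      have "prefix_prod K \<one>\<^bsub>K\<^esub> (gs \<sigma>) (Suc i) = e (\<sigma> i) \<otimes>\<^bsub>K\<^esub> prefix_prod K \<one>\<^bsub>K\<^esub> (gs \<sigma>) i"
        using i lenth Acomm[OF pA[of i] eA[OF \<sigma>lt[OF \<sigma> i]]] by (simp add: prefix_prod_Suc)
      then show ?thesis using \<chi>[OF sA.mem_carrier[OF pA[of i]] i \<sigma>lt[OF \<sigma> i]] i by simp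
    qed
    then have "f (gs \<sigma>) \<one>\<^bsub>K\<^esub> = (\<Prod>i<Suc n. if i = \<sigma> i then 1 else 0)"
      unfolding f_def cup_cochain_def by (simp del: prod.lessThan_Suc)
    also have "\<dots> = (if \<sigma> = id then 1 else 0)"
    proof (cases "\<sigma> = id")
      case False
      then obtain i where "\<sigma> i \<noteq> i" by (auto simp: fun_eq_iff)
      moreover from this have "i \<in> {..<Suc n}" using \<sigma> by (auto simp: permutes_def)
      ultimately show ?thesis using False by (subst prod_zero) force+
    qed simp
    finally show ?thesis .
  qed
  have idP: "id \<in> ?P" by (simp add: permutes_id)
  have "(\<Sum>\<sigma>\<in>?P. sign \<sigma> * f (gs \<sigma>) \<one>\<^bsub>K\<^esub>) = (\<Sum>\<sigma>\<in>?P. if \<sigma> = id then 1 else 0)"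
    using val by (intro sum.cong) auto
  also have "\<dots> = 1" using idP by (simp add: sum.delta' finite_permutations)
  finally have "(\<Sum>\<sigma>\<in>?P. sign \<sigma> * f (gs \<sigma>) \<one>\<^bsub>K\<^esub>) = 1" .
  moreover have "(\<Sum>\<sigma>\<in>?P. sign \<sigma> * f (gs \<sigma>) \<one>\<^bsub>K\<^esub>) = 0"
  proof -
    have "(\<Sum>\<sigma>\<in>?P. sign \<sigma> * f (gs \<sigma>) \<one>\<^bsub>K\<^esub>) = (\<Sum>\<sigma>\<in>?P. sign \<sigma> *
      (H (tl (gs \<sigma>)) + (\<Sum>i=1..n. (-1) ^ i * H (merge_at K i (gs \<sigma>))) + (-1) ^ (n + 1) * H (take n (gs \<sigma>))))"
      using cob by (intro sum.cong) auto
    also have "\<dots> = 0" unfolding gs_def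
      by (rule antisymmetrised_coboundary) (use Acomm eA in auto)
    finally show ?thesis .
  qed
  ultimately show False by simp
qed

theorem theorem3:
  fixes G :: "('a, 'b) monoid_scheme" and l :: "'a \<Rightarrow> real" and S :: "'a set"
  assumes "group G"
    and "length_function G l" and "purely_positive G l" and "discrete_lf G l"
    and "subgroup S G"
    and "solvable (G\<lparr>carrier := S\<rparr>)"
    and "finite_vcd (G\<lparr>carrier := S\<rparr>)"
  shows "\<exists>N (n::nat). N \<lhd> G\<lparr>carrier := S\<rparr> \<and> finite (rcosets\<^bsub>G\<lparr>carrier := S\<rparr>\<^esub> N) \<and>
           G\<lparr>carrier := N\<rparr> \<cong> product_group {..<n} (\<lambda>_. integer_group)"
proof -
  interpret G: group G by fact
  let ?S = "G\<lparr>carrier := S\<rparr>"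
  interpret S: group ?S by (rule subgroup.subgroup_is_group[OF assms(5,1)])
  from assms(7) obtain K n where K: "subgroup K ?S" "finite (rcosets\<^bsub>?S\<^esub> K)"
    and tf: "torsion_free (?S\<lparr>carrier := K\<rparr>)" and cd: "cd_le (?S\<lparr>carrier := K\<rparr>) n"
    unfolding finite_vcd_def by blast
  let ?K = "?S\<lparr>carrier := K\<rparr>"
  have KG: "subgroup K G" by (rule G.incl_subgroup[OF assms(5) K(1)])
  interpret K: group ?K by (rule subgroup.subgroup_is_group[OF K(1) S.is_group])
  have lK: "length_function ?K l"
    using G.length_function_subgroup[OF assms(2) KG] by simp
  from assms(4) obtain c where c: "c > 0" "\<And>g. g \<in> carrier G \<Longrightarrow> l g \<noteq> 0 \<Longrightarrow> l g > c"
    unfolding discrete_lf_def by blast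
  \<comment> \<open>Torsion-freeness gives infinite order, pure positivity a nonzero length, and
    discreteness then a length above \<open>c\<close>.\<close>
  have gt: "l g > c" if g: "g \<in> carrier ?K" "g \<noteq> \<one>\<^bsub>?K\<^esub>" for g
  proof -
    have gG: "g \<in> carrier G" using g subgroup.mem_carrier[OF KG] by simp
    have "infinite_order ?K g" using tf g by (simp add: torsion_free_def)
    then have "infinite_order G g" by (simp add: infinite_order_def nat_pow_def)
    then have "l g > 0" using assms(3) gG by (simp add: purely_positive_def)
    with c(2)[OF gG] show ?thesis by simp
  qed
  have solv: "solvable ?K"
  proof -
    interpret inc: group_hom ?K ?S id
      using subgroup.mem_carrier[OF K(1)] by unfold_locales (auto simp: hom_def)
    show ?thesis by (rule inc.inj_hom_imp_solvable) (simp_all add: assms(6))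
  qed
  have rank: "rank_le (?K\<lparr>carrier := A\<rparr>) n"
    if "subgroup A ?K" "comm_group (?K\<lparr>carrier := A\<rparr>)" for A
    by (rule rank_le_of_cd_le[OF K.is_group cd that])
  obtain A where A: "subgroup A ?K" "\<And>x y. x \<in> A \<Longrightarrow> y \<in> A \<Longrightarrow> x \<otimes>\<^bsub>?K\<^esub> y = y \<otimes>\<^bsub>?K\<^esub> x"
    "finite (rcosets\<^bsub>?K\<^esub> A)"
    using K.virtually_abelian[OF solv lK c(1) gt rank] by blast
  have AS: "subgroup A ?S" by (rule S.incl_subgroup[OF K(1) A(1)])
  have "finite (rcosets\<^bsub>?S\<^esub> A)" by (rule S.finite_rcosets_trans[OF K A(1,3)])
  \<comment> \<open>\<open>A\<close> need not be normal in \<open>S\<close>, hence the passage to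
    the core. As a commutative subgroup of \<open>K\<close>, the core inherits both the rank bound
    and the discrete norm.\<close>
  then obtain N where N: "N \<lhd> ?S" "N \<subseteq> A" "finite (rcosets\<^bsub>?S\<^esub> N)"
    using S.finite_index_core[OF AS] by blast
  have NK: "subgroup N ?K"
    using S.subgroup_incl[OF normal_imp_subgroup[OF N(1)] K(1)] N(2) subgroup.subset[OF A(1)] by auto
  interpret N: discrete_normed_group "?K\<lparr>carrier := N\<rparr>" l c
    by (rule K.discrete_normed_subgroup[OF lK c(1) gt NK]) (use A(2) N(2) in auto)
  have "rank_le (?K\<lparr>carrier := N\<rparr>) n" by (rule rank[OF NK]) unfold_locales
  from N.iso_integer_lattice[OF this] obtain s where
    "?K\<lparr>carrier := N\<rparr> \<cong> product_group {..<s::nat} (\<lambda>_. integer_group)" by blast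
  then have "G\<lparr>carrier := N\<rparr> \<cong> product_group {..<s} (\<lambda>_. integer_group)" by simp
  with N show ?thesis by blast
qed

end
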